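(* Let $N\ge 3$, let $\zeta\in\mathbb C$ satisfy $\zeta^N=-1$, and let $R(\zeta)$ be the integral of the Seiberg-Witten differential from the $\mathbb Z_N$-symmetric point to the small branch point labelled by $\zeta$ (as defined in the context), regarded as a function of $v=v_0=1-u_0\neq 0$ and of the rescaled moduli $v_1,\dots,v_{N-2}$. Then, around $v_n=0$ for all $n=1,\dots,N-2$ and for $v\ne0$ (i.e. for $0<|v|$ and $|v_1|,\dots,|v_{N-2}|$ sufficiently small), $R(\zeta)$ admits the convergent series expansion $$ R(\zeta)=\frac{v^{\frac12+\frac1N}}{\sqrt{2\pi}\,N}\sum_{\ell_0,\ell_1,\dots,\ell_{N-2}=0}^{\infty}\frac{(-1)^{M+1}\,\zeta^{L}\,\Gamma\!\left(\tfrac LN\right)\Gamma\!\left(\ell_0+\tfrac12\right)^2}{\Gamma\!\left(\tfrac12\right)^2\,\Gamma\!\left(\tfrac32-2\alpha+\ell_0\right)}\;\frac{v_0^{\ell_0}v_1^{\ell_1}\cdots v_{N-2}^{\ell_{N-2}}}{2^{\ell_0}\,\ell_0!\,\ell_1!\cdots\ell_{N-2}!}, $$ where $$L=1+\sum_{j=1}^{N-2}j\,\ell_j,\qquad M=\sum_{j=1}^{N-2}\ell_j,\qquad \alpha=\frac{NM-L}{2N}.$$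
   Context: The Seiberg-Witten curve for gauge group $SU(N)$ without hypermultiplets (strong coupling scale $\Lambda=1$) is $y^2=A(x)^2-1$ with $A(x)=x^N-\sum_{n=0}^{N-2}u_nx^n$, and the Seiberg-Witten differential is $\lambda=xA'(x)\,dx/y$. The maximal Argyres-Douglas (AD) point considered is $u_0=1$, $u_n=0$ for $n\ge1$. Put $v=v_0=1-u_0$, fix a branch of $\log v$ (used for all powers of $v$), and define rescaled variables by $x=v^{1/N}z$ and $u_n=v^{1-\frac nN}v_n$ for $1\le n\le N-2$. With $P(z)=z^N-\sum_{n=1}^{N-2}v_nz^n+1$ the curve becomes $y^2=vP(z)\,(vP(z)-2)$ and $$\lambda=\frac{v^{\frac12+\frac1N}}{\sqrt{-2}}\;\frac{z\,P'(z)\,dz}{P(z)^{1/2}\left(1-\tfrac v2P(z)\right)^{1/2}}.$$ For small $v_1,\dots,v_{N-2}$ and each $\zeta$ with $\zeta^N=-1$, $P$ has a unique root $z_\zeta$ near $\zeta$ (with $z_\zeta=\zeta$ when all $v_n=0$, $n\ge 1$); these roots are the small branch points. $R(\zeta)$ is defined by $$i\pi R(\zeta)=\int_0^{z_\zeta}\lambda,$$ the path being a small deformation of the segment from $0$ to $\zeta$, where the square roots are continued along the path starting at $z=0$ from $P(0)^{1/2}=1$ and the principal value of $(1-v/2)^{1/2}$. The starting point $z=0$ represents one of the two $\mathbb Z_N$-symmetric points $(x,y)=(0,\pm\sqrt{v(v-2)})$ of the curve; changing the choice changes the overall sign of $R$. The sign is fixed here by $\sqrt{-2}=-i\sqrt2$,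 i.e. $y(0)=-i\sqrt{v(2-v)}$. By convention $1/\Gamma(p)=0$ when $p$ is a non-positive integer. *)

theory Defs
  imports "HOL-Complex_Analysis.Complex_Analysis"
begin

text \<open>
  Throughout, \<open>lv\<close> is a logarithm of \<open>v\<close>, i.e. \<open>v = exp lv\<close>; all powers of \<open>v\<close> are taken with
  respect to it. Only the values \<open>vs n\<close> with \<open>1 \<le> n \<le> N - 2\<close> are used.
\<close>

definition vpow :: "complex \<Rightarrow> real \<Rightarrow> complex" where
  "vpow lv a = exp (of_real a * lv)"

text \<open>The curve is \<open>y\<^sup>2 = A(x)\<^sup>2 - 1\<close>.\<close>

definition sw_A :: "nat \<Rightarrow> (nat \<Rightarrow> complex) \<Rightarrow> complex \<Rightarrow> complex" where
  "sw_A N u x = x ^ N - (\<Sum>n=0..N-2. u n * x ^ n)"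

definition sw_u :: "nat \<Rightarrow> complex \<Rightarrow> (nat \<Rightarrow> complex) \<Rightarrow> nat \<Rightarrow> complex" where
  "sw_u N lv vs n = (if n = 0 then 1 - exp lv else vpow lv (1 - real n / real N) * vs n)"

definition sw_x :: "nat \<Rightarrow> complex \<Rightarrow> complex \<Rightarrow> complex" where
  "sw_x N lv z = vpow lv (1 / real N) * z"

definition sw_P :: "nat \<Rightarrow> (nat \<Rightarrow> complex) \<Rightarrow> complex \<Rightarrow> complex" where
  "sw_P N vs z = z ^ N - (\<Sum>n=1..N-2. vs n * z ^ n) + 1"

lemma sw_A_rescaled:
  assumes "N \<ge> 2"
  shows "sw_A N (sw_u N lv vs) (sw_x N lv z) = exp lv * sw_P N vs z - 1"
proof -
  have pw: "vpow lv (1 / real N) ^ n = vpow lv (real n / real N)" for n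
    by (simp add: vpow_def exp_of_nat_mult [symmetric])
  have N: "vpow lv (1 / real N) ^ N = exp lv"
    using assms by (simp add: pw) (simp add: vpow_def)
  have t: "sw_u N lv vs n * sw_x N lv z ^ n = exp lv * (vs n * z ^ n)" if "n \<in> {1..N-2}" for n
  proof -
    have "vpow lv (1 - real n / real N) * vpow lv (real n / real N) = exp lv"
      by (simp add: vpow_def exp_add [symmetric] algebra_simps)
    then show ?thesis
      using that by (simp add: sw_u_def sw_x_def power_mult_distrib pw mult_ac)
  qed
  have "(\<Sum>n=0..N-2. sw_u N lv vs n * sw_x N lv z ^ n) =
        sw_u N lv vs 0 + (\<Sum>n=1..N-2. sw_u N lv vs n * sw_x N lv z ^ n)"
    by (simp add: sum.atLeast_Suc_atMost)
  also have "(\<Sum>n=1..N-2. sw_u N lv vs n * sw_x N lv z ^ n) = exp lv * (\<Sum>n=1..N-2. vs n * z ^ n)"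
    using t by (simp add: sum_distrib_left)
  finally show ?thesis
    unfolding sw_A_def
    by (simp add: sw_P_def sw_u_def sw_x_def power_mult_distrib N algebra_simps)
qed

definition small_root :: "nat \<Rightarrow> real \<Rightarrow> complex \<Rightarrow> (nat \<Rightarrow> complex) \<Rightarrow> complex" where
  "small_root N \<rho> \<zeta> vs = (THE z. z \<in> ball \<zeta> \<rho> \<and> sw_P N vs z = 0)"

definition continued_sqrt :: "(real \<Rightarrow> complex) \<Rightarrow> complex \<Rightarrow> (real \<Rightarrow> complex) \<Rightarrow> bool" where
  "continued_sqrt f a g \<longleftrightarrow>
     continuous_on {0..1} g \<and> (\<forall>t\<in>{0..1}. (g t)\<^sup>2 = f t) \<and> g 0 = a"

text \<open>
  \<open>\<gamma>\<close> is a path in the \<open>z\<close>-plane from \<open>0\<close> to the small branch point, uniformly \<open>\<rho>\<close>-close to the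
  segment from \<open>0\<close> to \<open>\<zeta>\<close> and meeting the zeros of \<open>P\<close> only at its end; \<open>p\<close> and \<open>q\<close> are the values
  along \<open>\<gamma>\<close> of the continuations of \<open>P\<^bsup>1/2\<^esup>\<close> and \<open>(1 - v P / 2)\<^bsup>1/2\<^esup>\<close>.
\<close>

definition sw_path ::
  "nat \<Rightarrow> real \<Rightarrow> complex \<Rightarrow> complex \<Rightarrow> (nat \<Rightarrow> complex) \<Rightarrow>
   (real \<Rightarrow> complex) \<Rightarrow> (real \<Rightarrow> complex) \<Rightarrow> (real \<Rightarrow> complex) \<Rightarrow> bool" where
  "sw_path N \<rho> \<zeta> lv vs \<gamma> p q \<longleftrightarrow>
     valid_path \<gamma> \<and> pathstart \<gamma> = 0 \<and> pathfinish \<gamma> = small_root N \<rho> \<zeta> vs \<and>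
     (\<forall>t\<in>{0..1}. dist (\<gamma> t) (linepath 0 \<zeta> t) < \<rho>) \<and>
     (\<forall>t\<in>{0..<1}. sw_P N vs (\<gamma> t) \<noteq> 0) \<and>
     continued_sqrt (\<lambda>t. sw_P N vs (\<gamma> t)) 1 p \<and>
     continued_sqrt (\<lambda>t. 1 - exp lv / 2 * sw_P N vs (\<gamma> t)) (csqrt (1 - exp lv / 2)) q"

text \<open>The sheet of the curve along the path, with \<open>-2\<close> having the square root \<open>- i \<surd>2\<close>.\<close>

definition sw_y :: "complex \<Rightarrow> (real \<Rightarrow> complex) \<Rightarrow> (real \<Rightarrow> complex) \<Rightarrow> real \<Rightarrow> complex" where
  "sw_y lv p q t = vpow lv (1/2) * (- \<i> * of_real (sqrt 2)) * p t * q t"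

lemma sw_y_on_curve:
  assumes "N \<ge> 2" "sw_path N \<rho> \<zeta> lv vs \<gamma> p q" "t \<in> {0..1}"
  shows "(sw_y lv p q t)\<^sup>2 = (sw_A N (sw_u N lv vs) (sw_x N lv (\<gamma> t)))\<^sup>2 - 1"
proof -
  have pq: "(p t)\<^sup>2 = sw_P N vs (\<gamma> t)" "(q t)\<^sup>2 = 1 - exp lv / 2 * sw_P N vs (\<gamma> t)"
    using assms(2,3) by (auto simp: sw_path_def continued_sqrt_def)
  have "(vpow lv (1/2))\<^sup>2 = exp lv"
    by (simp add: vpow_def exp_double [symmetric])
  moreover have "(- \<i> * complex_of_real (sqrt 2))\<^sup>2 = - 2"
    by (simp add: power_mult_distrib flip: of_real_power)
  ultimately have "(sw_y lv p q t)\<^sup>2 =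
      exp lv * (-2) * sw_P N vs (\<gamma> t) * (1 - exp lv / 2 * sw_P N vs (\<gamma> t))"
    unfolding sw_y_def power_mult_distrib pq by simp
  then show ?thesis
    unfolding sw_A_rescaled [OF assms(1)] by (simp add: algebra_simps power2_eq_square)
qed

text \<open>The Seiberg-Witten differential \<open>x A'(x) dx / y\<close>, pulled back to the path parameter.\<close>

definition sw_lambda ::
  "nat \<Rightarrow> complex \<Rightarrow> (nat \<Rightarrow> complex) \<Rightarrow>
   (real \<Rightarrow> complex) \<Rightarrow> (real \<Rightarrow> complex) \<Rightarrow> (real \<Rightarrow> complex) \<Rightarrow> real \<Rightarrow> complex" where
  "sw_lambda N lv vs \<gamma> p q t =
     (let x = (\<lambda>s. sw_x N lv (\<gamma> s))
      in x t * deriv (sw_A N (sw_u N lv vs)) (x t) / sw_y lv p q t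
           * vector_derivative x (at t within {0..1}))"

lemma sw_lambda_rescaled:
  assumes "N \<ge> 2" "t \<in> {0..1}" "\<gamma> differentiable (at t within {0..1})"
  shows "sw_lambda N lv vs \<gamma> p q t =
         vpow lv (1/2 + 1 / real N) / (- \<i> * of_real (sqrt 2)) *
         (\<gamma> t * deriv (sw_P N vs) (\<gamma> t) / (p t * q t)) * vector_derivative \<gamma> (at t within {0..1})"
proof -
  let ?c = "vpow lv (1 / real N)" and ?A = "sw_A N (sw_u N lv vs)" and ?P = "sw_P N vs"
  have c0: "?c \<noteq> 0" by (simp add: vpow_def)
  have "(\<gamma> has_vector_derivative vector_derivative \<gamma> (at t within {0..1})) (at t within {0..1})"
    using assms(3) vector_derivative_works by blast
  then have "((\<lambda>s. sw_x N lv (\<gamma> s)) has_vector_derivative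
               ?c * vector_derivative \<gamma> (at t within {0..1})) (at t within {0..1})"
    unfolding sw_x_def by (rule has_vector_derivative_mult_right)
  then have vd: "vector_derivative (\<lambda>s. sw_x N lv (\<gamma> s)) (at t within {0..1}) =
                 ?c * vector_derivative \<gamma> (at t within {0..1})"
    using assms(2) by (intro vector_derivative_within_closed_interval) auto
  have hP: "?P field_differentiable at z" for z
    unfolding sw_P_def by (intro derivative_intros)
  have A: "?A = (\<lambda>x. exp lv * ?P (x / ?c) - 1)"
    using sw_A_rescaled [OF assms(1), of lv vs "x / ?c" for x] c0 by (auto simp: sw_x_def)
  have "(?A has_field_derivative exp lv * (deriv ?P (sw_x N lv (\<gamma> t) / ?c) * (1 / ?c)))
          (at (sw_x N lv (\<gamma> t)))"
    unfolding A using c0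
    by (auto intro!: derivative_eq_intros
          DERIV_chain2 [OF DERIV_deriv_iff_field_differentiable [THEN iffD2, OF hP]])
  then have dA: "deriv ?A (sw_x N lv (\<gamma> t)) = exp lv * deriv ?P (\<gamma> t) / ?c"
    using c0 by (simp add: DERIV_imp_deriv sw_x_def)
  have e: "exp lv = vpow lv (1/2) * vpow lv (1/2)"
    by (simp add: vpow_def exp_add [symmetric] flip: distrib_right)
  have h0: "vpow lv (1/2) \<noteq> 0" by (simp add: vpow_def)
  have s: "vpow lv (1/2 + 1 / real N) = vpow lv (1/2) * ?c"
    by (simp add: vpow_def exp_add [symmetric] distrib_right)
  show ?thesis
    unfolding sw_lambda_def Let_def vd dA sw_y_def s e using c0 h0 by (simp add: sw_x_def mult_ac)
qed

text \<open>
  The integrand is unbounded at the end of the path, and for a general path the integral need only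
  exist as a Henstock-Kurzweil (improper) integral.
\<close>

definition sw_R ::
  "nat \<Rightarrow> complex \<Rightarrow> (nat \<Rightarrow> complex) \<Rightarrow>
   (real \<Rightarrow> complex) \<Rightarrow> (real \<Rightarrow> complex) \<Rightarrow> (real \<Rightarrow> complex) \<Rightarrow> complex" where
  "sw_R N lv vs \<gamma> p q = integral {0..1} (sw_lambda N lv vs \<gamma> p q) / (\<i> * of_real pi)"

definition idx_L :: "nat \<Rightarrow> (nat \<Rightarrow> nat) \<Rightarrow> nat" where
  "idx_L N l = 1 + (\<Sum>j=1..N-2. j * l j)"

definition idx_M :: "nat \<Rightarrow> (nat \<Rightarrow> nat) \<Rightarrow> nat" where
  "idx_M N l = (\<Sum>j=1..N-2. l j)"

definition idx_alpha :: "nat \<Rightarrow> (nat \<Rightarrow> nat) \<Rightarrow> real" where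
  "idx_alpha N l = (real N * real (idx_M N l) - real (idx_L N l)) / (2 * real N)"

text \<open>\<open>rGamma\<close> is the reciprocal Gamma function, which vanishes at the non-positive integers.\<close>

definition R_term :: "nat \<Rightarrow> complex \<Rightarrow> complex \<Rightarrow> (nat \<Rightarrow> complex) \<Rightarrow> (nat \<Rightarrow> nat) \<Rightarrow> complex" where
  "R_term N \<zeta> v vs l =
     (-1) ^ (idx_M N l + 1) * \<zeta> ^ idx_L N l *
     of_real (Gamma (real (idx_L N l) / real N) * (Gamma (real (l 0) + 1/2))\<^sup>2
              / (Gamma (1/2))\<^sup>2 * rGamma (3/2 - 2 * idx_alpha N l + real (l 0))) *
     (v ^ l 0 * (\<Prod>n=1..N-2. vs n ^ l n)) / (2 ^ l 0 * (\<Prod>n=0..N-2. fact (l n)))"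

end

theory Submission
  imports Defs
begin

text \<open>
  A primitive of \<open>f / P\<^bsup>1/2\<^esup>\<close> that vanishes at the simple zero of \<open>P\<close> has the form \<open>P\<^bsup>1/2\<^esup> E\<close> with \<open>E\<close>
  holomorphic and \<open>P E' + P' E / 2 = f\<close>. Hence the integral of \<open>\<lambda>\<close> along any admissible path is a
  multiple of \<open>- E 0\<close>, and no branch of a square root is left. Write \<open>P = Q - q\<close> with \<open>Q = 1 + z\<^bsup>N\<^esup>\<close>. Away from
  \<open>\<zeta>\<close> the function \<open>E (1 - q / Q)\<^bsup>1/2\<^esup>\<close> solves the same equation with \<open>Q\<close> in place of \<open>P\<close>, so its value at
  \<open>0\<close> is an integral over a loop around \<open>\<zeta>\<close>, on which everything may be expanded in powers of \<open>v\<close> and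
  the \<open>v\<^sub>n\<close>. Integration by parts brings the terms into the shape \<open>z\<^bsup>L-1\<^esup> Q\<^bsup>m+1/2\<^esup>\<close>, whose loop integrals
  satisfy the recursion of the Beta function in \<open>m\<close>, also where the integral up to \<open>\<zeta>\<close> diverges.
\<close>

text \<open>Expanding the segment integral directly in the v_n fails twice: its endpoint moves with
  them, and a term of degree M carries Q^(k-M+1/2), which is not integrable at \<zeta> once M \<ge>
  k+2. Besides, q/Q may have a pole at \<zeta>, so its smallness is only available at a distance
  from \<zeta>. The loop is fixed before v and the v_n are chosen, and |Q| has a positive lower
  bound on it; the smallness conditions are measured against this bound. As Q^(1/2) changes sign
  along the loop, a primitive Q^(1/2) X with single-valued X contributes twice its value at z = 0 up
  to sign, and nothing is ever evaluated at \<zeta>. Integration by parts removes P', so that each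
  multi-index yields a single monomial; the factor 1/(k+1/2) which it produces completes the square
  of Gamma(k+1/2). The theorem asserts unordered summability, hence the majorant on the whole index
  set instead of estimates for iterated sums.\<close>

subsection \<open>Square roots along paths\<close>

text \<open>
  \<open>(z - a)\<^bsup>1/2\<^esup> K z\<close> is the primitive of \<open>h z / (z - a)\<^bsup>1/2\<^esup>\<close> along the ray from \<open>a\<close>; the substitution
  \<open>z \<mapsto> a + r\<^sup>2 (z - a)\<close> removes the root from the integrand.
\<close>

lemma sqrt_weighted_primitive:
  fixes h :: "complex \<Rightarrow> complex"
  assumes "open U" "convex U" "h holomorphic_on U" "a \<in> U"
  obtains K where "K holomorphic_on U" "\<And>z. z \<in> U \<Longrightarrow> (z - a) * deriv K z + K z / 2 = h z"
proof -
  define m where "m z r = a + complex_of_real r ^ 2 * (z - a)" for z r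
  have m: "m z r \<in> U" if "z \<in> U" "r \<in> {0..1}" for z r
  proof -
    have "(1 - r\<^sup>2) *\<^sub>R a + r\<^sup>2 *\<^sub>R z \<in> U"
      using that assms by (intro convexD) (auto simp: power_le_one)
    then show ?thesis
      by (simp add: m_def scaleR_conv_of_real algebra_simps)
  qed
  have h': "(h has_field_derivative deriv h w) (at w)" if "w \<in> U" for w
    using that assms holomorphic_derivI by blast
  have ch: "continuous_on U h" "continuous_on U (deriv h)"
    using assms holomorphic_on_imp_continuous_on holomorphic_deriv by blast+
  define K where "K z = 2 * integral (cbox 0 1) (\<lambda>r. h (m z r))" for z
  define D where "D z = integral (cbox 0 1) (\<lambda>r. deriv h (m z r) * complex_of_real r ^ 2)" for z
  have cont: "continuous_on (cbox 0 1) (\<lambda>r. h (m z r))"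
    "continuous_on (cbox 0 1) (\<lambda>r. deriv h (m z r))" if "z \<in> U" for z
    using m[OF that] by (auto intro!: continuous_on_compose2[OF ch(1)] continuous_on_compose2[OF ch(2)]
        continuous_intros simp: m_def)
  have K0: "((\<lambda>z. integral (cbox 0 1) (\<lambda>r. h (m z r))) has_field_derivative D z) (at z within U)"
    if "z \<in> U" for z
    unfolding D_def
  proof (rule leibniz_rule_field_derivative[OF _ _ _ that \<open>convex U\<close>])
    show "((\<lambda>x. h (m x t)) has_field_derivative deriv h (m x t) * (complex_of_real t)\<^sup>2) (at x within U)"
      if "x \<in> U" "t \<in> cbox 0 1" for x t
      using that m[of x t] unfolding m_def
      by (intro DERIV_chain2[OF h']) (auto intro!: derivative_eq_intros)
    show "(\<lambda>r. h (m x r)) integrable_on cbox 0 1" if "x \<in> U" for x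
      using cont[OF that] integrable_continuous by blast
    have "continuous_on (U \<times> {0..1}) (\<lambda>x. deriv h (m (fst x) (snd x)))"
      using m by (intro continuous_on_compose2[OF ch(2)]) (auto simp: m_def intro!: continuous_intros)
    then show "continuous_on (U \<times> cbox 0 1) (\<lambda>(x, t). deriv h (m x t) * (complex_of_real t)\<^sup>2)"
      by (auto simp: case_prod_beta intro!: continuous_intros)
  qed
  have K': "(K has_field_derivative 2 * D z) (at z)" if "z \<in> U" for z
    using DERIV_cmult[OF K0[OF that], of 2] at_within_open[OF that \<open>open U\<close>] unfolding K_def
    by simp
  have "(z - a) * deriv K z + K z / 2 = h z" if z: "z \<in> U" for z
  proof -
    \<comment> \<open>The integrand is the r-derivative of r h(m z r), so its integral is h z. As K
      is twice the integral of h(m z r) and K' = 2 D, this is the claimed equation.\<close>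
    have "((\<lambda>r. h (m z r) + 2 * (z - a) * (deriv h (m z r) * complex_of_real r ^ 2))
          has_integral (complex_of_real 1 * h (m z 1) - complex_of_real 0 * h (m z 0))) {0..1}"
    proof (rule fundamental_theorem_of_calculus)
      fix r :: real assume r: "r \<in> {0..1}"
      have "((\<lambda>w. w * h (a + w\<^sup>2 * (z - a))) has_field_derivative
            h (m z r) + 2 * (z - a) * (deriv h (m z r) * complex_of_real r ^ 2)) (at (complex_of_real r))"
        using m[OF z r] unfolding m_def
        by (auto intro!: derivative_eq_intros DERIV_chain2[OF h'] simp: power2_eq_square)
      from has_vector_derivative_real_field[OF this]
      show "((\<lambda>r. complex_of_real r * h (m z r)) has_vector_derivative
            h (m z r) + 2 * (z - a) * (deriv h (m z r) * complex_of_real r ^ 2)) (at r within {0..1})"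
        unfolding m_def by simp
    qed simp
    moreover have "((\<lambda>r. h (m z r) + 2 * (z - a) * (deriv h (m z r) * complex_of_real r ^ 2)) has_integral
        integral (cbox 0 1) (\<lambda>r. h (m z r)) + 2 * (z - a) * D z) {0..1}"
      unfolding D_def using cont[OF z]
      by (intro has_integral_add has_integral_mult_right)
        (auto intro!: integrable_integral integrable_continuous_interval continuous_intros)
    ultimately have "integral (cbox 0 1) (\<lambda>r. h (m z r)) + 2 * (z - a) * D z = h z"
      by (auto dest: has_integral_unique simp: m_def)
    then show ?thesis
      unfolding DERIV_imp_deriv[OF K'[OF z]] K_def by (simp only: mult.assoc mult.left_commute) (simp add: add.commute)
  qed
  moreover have "K holomorphic_on U"
    using K' assms(1) holomorphic_on_open by blast
  ultimately show thesis by (rule that[rotated])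
qed

text \<open>The quotient P / (z - a), completed by P'(a) at a, is holomorphic and zero-free, and on
  a convex set such a function has a holomorphic square root.\<close>

lemma simple_zero_sqrt_factor:
  assumes "open U" "convex U" "P holomorphic_on U" "a \<in> U" "P a = 0" "deriv P a \<noteq> 0"
    and "\<And>z. z \<in> U \<Longrightarrow> P z = 0 \<Longrightarrow> z = a"
  obtains G where "G holomorphic_on U" "\<And>z. z \<in> U \<Longrightarrow> G z \<noteq> 0" "\<And>z. z \<in> U \<Longrightarrow> P z = (z - a) * (G z)\<^sup>2"
proof -
  define g where "g z = (if z = a then deriv P a else (P z - P a) / (z - a))" for z
  have "g holomorphic_on U"
    using pole_lemma_open[OF assms(3,1), of a] by (simp add: g_def[abs_def])
  moreover have nz: "g z \<noteq> 0" if "z \<in> U" for z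
  proof (cases "z = a")
    case False
    with assms(7)[OF that] have "P z \<noteq> 0" by blast
    with False assms(5) show ?thesis by (simp add: g_def)
  qed (use assms(6) in \<open>simp add: g_def\<close>)
  ultimately obtain G where G: "G holomorphic_on U" "\<And>z. z \<in> U \<Longrightarrow> g z = G z ^ 2"
    using contractible_imp_holomorphic_sqrt[OF _ convex_imp_contractible[OF assms(2)], of g] by blast
  have "P z = (z - a) * (G z)\<^sup>2" if "z \<in> U" for z
    using G(2)[OF that] assms(5) by (cases "z = a") (auto simp: g_def field_simps)
  moreover have "G z \<noteq> 0" if "z \<in> U" for z
    using G(2)[OF that] nz[OF that] by auto
  ultimately show thesis
    using G(1) that by blast
qed

text \<open>The equation says that \<open>P\<^bsup>1/2\<^esup> E\<close> is a primitive of \<open>f / P\<^bsup>1/2\<^esup>\<close>, without mentioning a branch.\<close>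

lemma singular_ode_solution:
  assumes "open U" "convex U" "P holomorphic_on U" "f holomorphic_on U" "a \<in> U" "P a = 0" "deriv P a \<noteq> 0"
    and "\<And>z. z \<in> U \<Longrightarrow> P z = 0 \<Longrightarrow> z = a"
  obtains E where "E holomorphic_on U" "\<And>z. z \<in> U \<Longrightarrow> P z * deriv E z + deriv P z * E z / 2 = f z"
proof -
  obtain G where G: "G holomorphic_on U" "\<And>z. z \<in> U \<Longrightarrow> G z \<noteq> 0" "\<And>z. z \<in> U \<Longrightarrow> P z = (z - a) * (G z)\<^sup>2"
    using simple_zero_sqrt_factor[OF assms(1-3,5-8)] by blast
  \<comment> \<open>With P = (z - a) G^2 and E = K / G the terms containing G' cancel, and the
    equation for E becomes G times the one for K with right-hand side f / G.\<close>
  obtain K where K: "K holomorphic_on U" "\<And>z. z \<in> U \<Longrightarrow> (z - a) * deriv K z + K z / 2 = f z / G z"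
    using sqrt_weighted_primitive[of U "\<lambda>z. f z / G z" a] assms G by (metis holomorphic_on_divide)
  define E where "E z = K z / G z" for z
  show thesis
  proof
    show "E holomorphic_on U"
      unfolding E_def using K G by (intro holomorphic_intros) auto
    fix z assume z: "z \<in> U"
    have dK: "(K has_field_derivative deriv K z) (at z)" and dG: "(G has_field_derivative deriv G z) (at z)"
      using z K G assms(1) holomorphic_derivI by blast+
    have "(E has_field_derivative (deriv K z * G z - K z * deriv G z) / (G z * G z)) (at z)"
      unfolding E_def using dK dG G(2)[OF z] by (rule DERIV_divide)
    then have E': "deriv E z = (deriv K z * G z - K z * deriv G z) / (G z * G z)"
      by (rule DERIV_imp_deriv)
    have "((\<lambda>z. (z - a) * (G z)\<^sup>2) has_field_derivative ((G z)\<^sup>2 + 2 * (z - a) * G z * deriv G z)) (at z)"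
      using dG by (auto intro!: derivative_eq_intros)
    then have "(P has_field_derivative ((G z)\<^sup>2 + 2 * (z - a) * G z * deriv G z)) (at z)"
      by (rule has_field_derivative_transform_within_open[OF _ assms(1) z]) (simp add: G)
    then have P': "deriv P z = ((G z)\<^sup>2 + 2 * (z - a) * G z * deriv G z)"
      by (rule DERIV_imp_deriv)
    have "P z * deriv E z + deriv P z * E z / 2 = G z * ((z - a) * deriv K z + K z / 2)"
      unfolding E' P' E_def G(3)[OF z] using G(2)[OF z] by (simp add: field_simps power2_eq_square)
    also have "\<dots> = f z"
      using K(2)[OF z] G(2)[OF z] by simp
    finally show "P z * deriv E z + deriv P z * E z / 2 = f z" .
  qed
qed

text \<open>Near t the ratio g s / g t has positive real part, so it is the principal root of f s /
  f t; thus g is locally a fixed multiple of \<open>csqrt\<close> applied to f.\<close>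

lemma has_vector_derivative_continuous_sqrt:
  fixes f g :: "real \<Rightarrow> complex"
  assumes f: "(f has_vector_derivative f') (at t)" and g: "isCont g t" "g t \<noteq> 0"
    and sq: "\<forall>\<^sub>F s in nhds t. (g s)\<^sup>2 = f s"
  shows "(g has_vector_derivative f' / (2 * g t)) (at t)"
proof -
  have ft: "f t = (g t)\<^sup>2"
    using eventually_nhds_x_imp_x[OF sq] by simp
  have "((\<lambda>s. Re (g s / g t)) \<longlongrightarrow> Re (g t / g t)) (nhds t)"
    using g by (intro tendsto_intros) (auto simp: isCont_def tendsto_at_iff_tendsto_nhds)
  then have "\<forall>\<^sub>F s in nhds t. 0 < Re (g s / g t)"
    using g by (intro order_tendstoD(1)) auto
  with sq have ev: "\<forall>\<^sub>F s in nhds t. g t * csqrt (f s / f t) = g s"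
  proof eventually_elim
    case (elim s)
    have "csqrt (f s / f t) = csqrt ((g s / g t)\<^sup>2)"
      using elim by (simp add: ft power_divide)
    also have "\<dots> = g s / g t"
      using elim by (intro csqrt_square) auto
    finally show ?case
      using g by simp
  qed
  have "((\<lambda>w. g t * csqrt (w / f t)) has_field_derivative 1 / (2 * g t)) (at (f t))"
    using g ft by (auto intro!: derivative_eq_intros simp: field_simps power2_eq_square)
  from field_vector_diff_chain_at[OF f this]
  have "((\<lambda>s. g t * csqrt (f s / f t)) has_vector_derivative f' / (2 * g t)) (at t)"
    by (simp add: o_def)
  moreover obtain S where "open S" "t \<in> S" "\<And>s. s \<in> S \<Longrightarrow> g t * csqrt (f s / f t) = g s"
    using ev unfolding eventually_nhds by blast
  ultimately show ?thesis
    by (rule has_vector_derivative_transform_within_open)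
qed

text \<open>The product of p and E along \<gamma> is a primitive of the integrand wherever \<gamma>
  is differentiable in the open interval. At the end the integrand may blow up, but the product
  stays continuous and vanishes together with p; this form of the fundamental theorem needs no more.
  Only the starting value survives.\<close>

lemma has_integral_continued_sqrt:
  assumes U: "open U" "P holomorphic_on U" "E holomorphic_on U"
    and ode: "\<And>z. z \<in> U \<Longrightarrow> P z * deriv E z + deriv P z * E z / 2 = f z"
    and \<gamma>: "valid_path \<gamma>" "path_image \<gamma> \<subseteq> U"
    and p: "continued_sqrt (\<lambda>t. P (\<gamma> t)) s p"
    and nz: "\<And>t. t \<in> {0..<1} \<Longrightarrow> P (\<gamma> t) \<noteq> 0" and fin: "P (pathfinish \<gamma>) = 0"
  shows "((\<lambda>t. f (\<gamma> t) / p t * vector_derivative \<gamma> (at t within {0..1})) has_integral - (s * E (pathstart \<gamma>))) {0..1}"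
proof -
  obtain S where S: "finite S" "\<And>t. t \<in> {0..1} - S \<Longrightarrow> \<gamma> differentiable at t"
    using \<gamma>(1) unfolding valid_path_def piecewise_C1_differentiable_on_def C1_differentiable_on_eq by blast
  have c\<gamma>: "continuous_on {0..1} \<gamma>" and \<gamma>U: "\<And>t. t \<in> {0..1} \<Longrightarrow> \<gamma> t \<in> U"
    using \<gamma> valid_path_imp_path by (auto simp: path_def path_image_def)
  have cp: "continuous_on {0..1} p" and p2: "\<And>t. t \<in> {0..1} \<Longrightarrow> (p t)\<^sup>2 = P (\<gamma> t)" and p0: "p 0 = s"
    using p by (auto simp: continued_sqrt_def)
  have cE: "continuous_on {0..1} (\<lambda>t. E (\<gamma> t))"
    using U \<gamma>U by (intro continuous_on_compose2[OF holomorphic_on_imp_continuous_on c\<gamma>]) auto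
  have "((\<lambda>t. f (\<gamma> t) / p t * vector_derivative \<gamma> (at t within {0..1})) has_integral
        p 1 * E (\<gamma> 1) - p 0 * E (\<gamma> 0)) {0..1}"
  proof (rule fundamental_theorem_of_calculus_interior_strong[OF \<open>finite S\<close>])
    fix t assume "t \<in> {0<..<1} - S"
    then have t: "t \<in> {0<..<1}" "t \<in> {0..1}" "t \<in> {0..<1}" "t \<notin> S" by auto
    let ?d = "vector_derivative \<gamma> (at t within {0..1})"
    have d: "(\<gamma> has_vector_derivative ?d) (at t)"
      using S(2)[of t] t vector_derivative_works[of \<gamma> "at t"] vector_derivative_within_closed_interval[of 0 1 t]
      by (auto simp: at_within_Icc_at)
    have dP: "(P has_field_derivative deriv P (\<gamma> t)) (at (\<gamma> t))" and dE: "(E has_field_derivative deriv E (\<gamma> t)) (at (\<gamma> t))"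
      using U \<gamma>U[OF t(2)] holomorphic_derivI by blast+
    have pt: "p t \<noteq> 0"
      using nz[OF t(3)] p2[OF t(2)] by auto
    have "isCont p t"
      using cp t(1) by (intro continuous_on_interior[of "{0..1}"]) auto
    moreover have "\<forall>\<^sub>F s in nhds t. (p s)\<^sup>2 = P (\<gamma> s)"
      using eventually_nhds_in_open[of "{0<..<1}" t] t(1) by (auto elim!: eventually_mono intro: p2)
    ultimately have "(p has_vector_derivative (?d * deriv P (\<gamma> t)) / (2 * p t)) (at t)"
      using field_vector_diff_chain_at[OF d dP] pt
      by (intro has_vector_derivative_continuous_sqrt[where f = "\<lambda>s. P (\<gamma> s)"]) (auto simp: o_def)
    moreover have "((\<lambda>t. E (\<gamma> t)) has_vector_derivative ?d * deriv E (\<gamma> t)) (at t)"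
      using field_vector_diff_chain_at[OF d dE] by (simp add: o_def)
    ultimately have "((\<lambda>t. p t * E (\<gamma> t)) has_vector_derivative
          (p t * (?d * deriv E (\<gamma> t)) + (?d * deriv P (\<gamma> t)) / (2 * p t) * E (\<gamma> t))) (at t)"
      by (rule has_vector_derivative_mult)
    also have "p t * (?d * deriv E (\<gamma> t)) + (?d * deriv P (\<gamma> t)) / (2 * p t) * E (\<gamma> t) = f (\<gamma> t) / p t * ?d"
      unfolding ode[OF \<gamma>U[OF t(2)], symmetric] p2[OF t(2), symmetric]
      using pt by (simp add: field_simps power2_eq_square)
    finally show "((\<lambda>t. p t * E (\<gamma> t)) has_vector_derivative f (\<gamma> t) / p t * ?d) (at t)" .
  qed (use cp cE in \<open>auto intro!: continuous_intros\<close>)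
  moreover have "p 1 = 0"
    using p2[of 1] fin by (simp add: pathfinish_def)
  ultimately show ?thesis
    by (simp add: p0 pathstart_def)
qed

subsection \<open>Sums over multi-indices\<close>

text \<open>The multinomial theorem divided by M!, by splitting off one coordinate and using the
  binomial theorem. Finiteness is carried through the same induction because the sum over the split
  index set relies on it.\<close>

lemma multinomial_PiE:
  fixes y :: "'a \<Rightarrow> 'b::field_char_0"
  assumes "finite J"
  shows "finite {l \<in> J \<rightarrow>\<^sub>E UNIV. sum l J = M} \<and>
    (\<Sum>l | l \<in> J \<rightarrow>\<^sub>E UNIV \<and> sum l J = M. \<Prod>j\<in>J. y j ^ l j / fact (l j)) = sum y J ^ M / fact M"
  using assms
proof (induction J arbitrary: M rule: finite_induct)
  case empty
  show ?case
    by (cases M) auto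
next
  case (insert x J)
  let ?S = "\<lambda>M. {l \<in> J \<rightarrow>\<^sub>E UNIV. sum l J = M}"
  let ?h = "\<lambda>(i, l). l(x := i)"
  have upd: "sum (l(x := i)) J = sum l J" for l :: "'a \<Rightarrow> nat" and i
    using insert by (intro sum.cong) auto
  have eq: "{l \<in> insert x J \<rightarrow>\<^sub>E UNIV. sum l (insert x J) = M} = ?h ` (SIGMA i:{..M}. ?S (M - i))"
  proof (intro equalityI subsetI)
    fix l assume l: "l \<in> {l \<in> insert x J \<rightarrow>\<^sub>E UNIV. sum l (insert x J) = M}"
    have u: "sum (l(x := undefined)) J = sum l J" by (rule upd)
    have "l = ?h (l x, l(x := undefined))" by simp
    moreover have "(l x, l(x := undefined)) \<in> (SIGMA i:{..M}. ?S (M - i))"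
      using l insert.hyps u by (auto simp: PiE_def extensional_def)
    ultimately show "l \<in> ?h ` (SIGMA i:{..M}. ?S (M - i))" by blast
  next
    fix l assume "l \<in> ?h ` (SIGMA i:{..M}. ?S (M - i))"
    then obtain i l' where l: "l = l'(x := i)" "i \<le> M" "l' \<in> J \<rightarrow>\<^sub>E UNIV" "sum l' J = M - i" by auto
    have "sum l J = sum l' J" unfolding l(1) by (rule upd)
    then show "l \<in> {l \<in> insert x J \<rightarrow>\<^sub>E UNIV. sum l (insert x J) = M}"
      using l insert.hyps by (auto simp: PiE_def extensional_def)
  qed
  have inj: "inj_on ?h (SIGMA i:{..M}. ?S (M - i))"
    using insert(2) by (intro inj_on_subset[OF inj_combinator[of x J "\<lambda>_. UNIV"]]) auto
  have "(\<Sum>l | l \<in> insert x J \<rightarrow>\<^sub>E UNIV \<and> sum l (insert x J) = M. \<Prod>j\<in>insert x J. y j ^ l j / fact (l j))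
      = (\<Sum>(i, l)\<in>(SIGMA i:{..M}. ?S (M - i)). \<Prod>j\<in>insert x J. y j ^ (l(x := i)) j / fact ((l(x := i)) j))"
    unfolding eq by (subst sum.reindex[OF inj]) (auto simp: case_prod_unfold intro!: sum.cong)
  also have "\<dots> = (\<Sum>(i, l)\<in>(SIGMA i:{..M}. ?S (M - i)). y x ^ i / fact i * (\<Prod>j\<in>J. y j ^ l j / fact (l j)))"
  proof (intro sum.cong refl, clarify)
    fix i l
    have "(\<Prod>j\<in>J. y j ^ (l(x := i)) j / fact ((l(x := i)) j)) = (\<Prod>j\<in>J. y j ^ l j / fact (l j))"
      using insert.hyps by (intro prod.cong) auto
    then show "(\<Prod>j\<in>insert x J. y j ^ (l(x := i)) j / fact ((l(x := i)) j)) =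
        y x ^ i / fact i * (\<Prod>j\<in>J. y j ^ l j / fact (l j))"
      using insert.hyps by simp
  qed
  also have "\<dots> = (\<Sum>i\<le>M. \<Sum>l\<in>?S (M - i). y x ^ i / fact i * (\<Prod>j\<in>J. y j ^ l j / fact (l j)))"
    using insert by (subst sum.Sigma) auto
  also have "\<dots> = (\<Sum>i\<le>M. y x ^ i / fact i * (sum y J ^ (M - i) / fact (M - i)))"
    by (simp only: sum_distrib_left[symmetric] insert.IH[THEN conjunct2])
  also have "\<dots> = (y x + sum y J) ^ M / fact M"
    unfolding binomial_ring sum_divide_distrib
    by (intro sum.cong refl) (auto simp: binomial_fact field_simps)
  finally show ?case
    using insert eq by auto
qed

text \<open>Multi-indices are grouped by their total degree M. Each group is finite and summed by
  the multinomial theorem; absolute convergence over M then gives an unordered sum. The version with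
  norms supplies the exact value of the later majorants.\<close>

lemma has_sum_multinomial:
  fixes y :: "'a \<Rightarrow> 'b::{real_normed_field, banach}"
  assumes "finite J" "summable (\<lambda>M. norm (c M) / fact M * (\<Sum>j\<in>J. norm (y j)) ^ M)"
  shows "((\<lambda>l. norm (c (sum l J) * (\<Prod>j\<in>J. y j ^ l j / fact (l j)))) has_sum 
          (\<Sum>M. norm (c M) / fact M * (\<Sum>j\<in>J. norm (y j)) ^ M)) (J \<rightarrow>\<^sub>E UNIV)"
    and "((\<lambda>l. c (sum l J) * (\<Prod>j\<in>J. y j ^ l j / fact (l j))) has_sum (\<Sum>M. c M / fact M * (\<Sum>j\<in>J. y j) ^ M))
          (J \<rightarrow>\<^sub>E UNIV)"
proof -
  let ?S = "\<lambda>M. {l \<in> J \<rightarrow>\<^sub>E UNIV. sum l J = M}"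
  let ?b = "\<lambda>l. c (sum l J) * (\<Prod>j\<in>J. y j ^ l j / fact (l j))"
  have bij: "bij_betw snd (Sigma UNIV ?S) (J \<rightarrow>\<^sub>E UNIV)"
    by (auto simp: bij_betw_def inj_on_def image_iff)
  have n: "norm (?b l) = norm (c (sum l J)) * (\<Prod>j\<in>J. norm (y j) ^ l j / fact (l j))" for l
    by (simp add: norm_mult norm_divide norm_power flip: prod_norm)
  have inner_norm: "((\<lambda>l. norm (?b l)) has_sum norm (c M) / fact M * (\<Sum>j\<in>J. norm (y j)) ^ M) (?S M)" for M
  proof -
    have "(\<Sum>l\<in>?S M. norm (?b l)) = norm (c M) * (\<Sum>l\<in>?S M. \<Prod>j\<in>J. norm (y j) ^ l j / fact (l j))"
      unfolding n sum_distrib_left by (intro sum.cong) auto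
    also have "\<dots> = norm (c M) / fact M * (\<Sum>j\<in>J. norm (y j)) ^ M"
      using multinomial_PiE[OF assms(1), of M "\<lambda>j. norm (y j)"] by simp
    finally show ?thesis
      using multinomial_PiE[OF assms(1), of M y] has_sum_finite[of "?S M" "\<lambda>l. norm (?b l)"] by simp
  qed
  have inner: "(?b has_sum c M / fact M * (\<Sum>j\<in>J. y j) ^ M) (?S M)" for M
  proof -
    have "(\<Sum>l\<in>?S M. ?b l) = c M * (\<Sum>l\<in>?S M. \<Prod>j\<in>J. y j ^ l j / fact (l j))"
      unfolding sum_distrib_left by (intro sum.cong) auto
    then show ?thesis
      using multinomial_PiE[OF assms(1), of M y] has_sum_finite[of "?S M" ?b] by simp
  qed
  have s0: "summable (\<lambda>M. norm (c M / fact M * (\<Sum>j\<in>J. y j) ^ M))"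
    by (rule summable_comparison_test[OF _ assms(2)])
      (auto simp: norm_mult norm_divide norm_power intro!: exI[of _ 0] mult_left_mono power_mono norm_sum divide_right_mono)
  have outer_norm: "((\<lambda>M. norm (c M) / fact M * (\<Sum>j\<in>J. norm (y j)) ^ M) has_sum
      (\<Sum>M. norm (c M) / fact M * (\<Sum>j\<in>J. norm (y j)) ^ M)) UNIV"
    using assms(2) by (intro norm_summable_imp_has_sum) (auto simp: sum_nonneg summable_sums)
  have outer: "((\<lambda>M. c M / fact M * (\<Sum>j\<in>J. y j) ^ M) has_sum (\<Sum>M. c M / fact M * (\<Sum>j\<in>J. y j) ^ M)) UNIV"
    using s0 by (intro norm_summable_imp_has_sum) (auto intro: summable_sums summable_norm_cancel)
  have sm: "(\<lambda>x. norm (?b (snd x))) summable_on (Sigma UNIV ?S)"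
    using inner_norm outer_norm by (intro summable_on_SigmaI) (auto simp: summable_on_def)
  have "((\<lambda>x. norm (?b (snd x))) has_sum (\<Sum>M. norm (c M) / fact M * (\<Sum>j\<in>J. norm (y j)) ^ M)) (Sigma UNIV ?S)"
    using inner_norm outer_norm sm by (intro has_sum_SigmaI) auto
  then show "((\<lambda>l. norm (?b l)) has_sum (\<Sum>M. norm (c M) / fact M * (\<Sum>j\<in>J. norm (y j)) ^ M)) (J \<rightarrow>\<^sub>E UNIV)"
    using has_sum_reindex_bij_betw[OF bij, of "\<lambda>l. norm (?b l)"] by simp
  have "((\<lambda>x. ?b (snd x)) has_sum (\<Sum>M. c M / fact M * (\<Sum>j\<in>J. y j) ^ M)) (Sigma UNIV ?S)"
    using inner outer abs_summable_summable[OF sm] by (intro has_sum_SigmaI) auto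
  then show "(?b has_sum (\<Sum>M. c M / fact M * (\<Sum>j\<in>J. y j) ^ M)) (J \<rightarrow>\<^sub>E UNIV)"
    using has_sum_reindex_bij_betw[OF bij, of ?b] by simp
qed

text \<open>The Weierstrass M-test makes the finite partial sums converge uniformly along the filter
  of finite subsets, and contour integration commutes with uniform limits.\<close>

lemma has_sum_contour_integral:
  assumes "\<And>i w. i \<in> I \<Longrightarrow> w \<in> path_image \<gamma> \<Longrightarrow> norm (f i w) \<le> B i" "B summable_on I"
    and "\<And>w. w \<in> path_image \<gamma> \<Longrightarrow> ((\<lambda>i. f i w) has_sum g w) I"
    and "\<And>i. i \<in> I \<Longrightarrow> f i contour_integrable_on \<gamma>"
    and "valid_path \<gamma>" "\<And>t. t \<in> {0..1} \<Longrightarrow> norm (vector_derivative \<gamma> (at t)) \<le> D"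
  shows "g contour_integrable_on \<gamma>"
    and "((\<lambda>i. contour_integral \<gamma> (f i)) has_sum contour_integral \<gamma> g) I"
proof -
  have ul: "uniform_limit (path_image \<gamma>) (\<lambda>X w. \<Sum>i\<in>X. f i w) g (finite_subsets_at_top I)"
    using assms(1,3,2) by (rule Weierstrass_m_test_general')
  have ev: "\<forall>\<^sub>F X in finite_subsets_at_top I. (\<lambda>w. \<Sum>i\<in>X. f i w) contour_integrable_on \<gamma>"
    using assms(4) by (intro eventually_finite_subsets_at_top_weakI contour_integrable_sum) auto
  note lim = contour_integral_uniform_limit[OF ev ul assms(6,5) finite_subsets_at_top_neq_bot]
  show "g contour_integrable_on \<gamma>"
    by (rule lim)
  show "((\<lambda>i. contour_integral \<gamma> (f i)) has_sum contour_integral \<gamma> g) I"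
    unfolding has_sum_def
  proof (rule Lim_transform_eventually[OF lim(2)])
    show "\<forall>\<^sub>F X in finite_subsets_at_top I. contour_integral \<gamma> (\<lambda>w. \<Sum>i\<in>X. f i w) = (\<Sum>i\<in>X. contour_integral \<gamma> (f i))"
      using assms(4) by (intro eventually_finite_subsets_at_top_weakI contour_integral_sum) auto
  qed
qed

subsection \<open>Loop integrals around the unperturbed branch point\<close>

text \<open>
  The loop around \<open>\<zeta>\<close> is parametrised by \<open>z = \<zeta> (1 - s\<^sup>2)\<close>, which makes \<open>s H(z)\<close> a single-valued square
  root of \<open>1 + z\<^bsup>N\<^esup>\<close>. It starts and ends at \<open>z = 0\<close> while \<open>s\<close> runs from \<open>1\<close> to \<open>-1\<close>, avoiding \<open>s = 0\<close>.
\<close>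

locale half_loop =
  fixes N :: nat and \<zeta> :: complex and U :: "complex set" and H :: "complex \<Rightarrow> complex" and \<delta> :: real
  assumes N: "N \<ge> 3" and \<zeta>: "\<zeta> ^ N = -1"
    and U: "open U" "convex U" "0 \<in> U" "\<zeta> \<in> U" "\<And>z. z \<in> U \<Longrightarrow> 1 + z ^ N = 0 \<Longrightarrow> z = \<zeta>"
    and H: "H holomorphic_on U" "\<And>z. z \<in> U \<Longrightarrow> H z \<noteq> 0" "H 0 = 1"
      "\<And>z. z \<in> U \<Longrightarrow> 1 + z ^ N = (1 - z / \<zeta>) * (H z)\<^sup>2"
    and \<delta>: "\<delta> > 0"
    and in_U: "\<And>s. s \<in> path_image (linepath 1 (\<i> * of_real \<delta>) +++ linepath (\<i> * of_real \<delta>) (-1)) \<Longrightarrow> \<zeta> * (1 - s\<^sup>2) \<in> U"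
begin

definition loop :: "real \<Rightarrow> complex" where
  "loop = linepath 1 (\<i> * of_real \<delta>) +++ linepath (\<i> * of_real \<delta>) (-1)"

definition w :: "complex \<Rightarrow> complex" where "w s = \<zeta> * (1 - s\<^sup>2)"

definition Q :: "complex \<Rightarrow> complex" where "Q z = 1 + z ^ N"

text \<open>Half the integral of \<open>- R / Q\<^bsup>1/2\<^esup>\<close> over the loop.\<close>

definition T :: "(complex \<Rightarrow> complex) \<Rightarrow> complex" where
  "T R = \<zeta> * contour_integral loop (\<lambda>s. R (w s) / H (w s))"

lemma \<zeta>_nz: "\<zeta> \<noteq> 0"
  using \<zeta> N by (auto simp: power_0_left)

lemma loop_simps [simp]: "pathstart loop = 1" "pathfinish loop = -1" "valid_path loop"
  by (auto simp: loop_def)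

lemma path_image_loop: "path_image loop = closed_segment 1 (\<i> * of_real \<delta>) \<union> closed_segment (\<i> * of_real \<delta>) (-1)"
  by (simp add: loop_def path_image_join)

lemma loop_nz: "s \<noteq> 0" if "s \<in> path_image loop"
proof
  assume "s = 0"
  with that obtain u where "0 = (1 - u) *\<^sub>R 1 + u *\<^sub>R (\<i> * complex_of_real \<delta>) \<or>
      0 = (1 - u) *\<^sub>R (\<i> * complex_of_real \<delta>) + u *\<^sub>R (-1 :: complex)"
    by (auto simp: path_image_loop in_segment)
  then show False
    using \<delta> by (auto simp: complex_eq_iff)
qed

lemma w_in_U: "w s \<in> U" if "s \<in> path_image loop"
  using in_U that by (simp add: w_def loop_def)

lemma Q_w: "Q (w s) = s\<^sup>2 * (H (w s))\<^sup>2" if "s \<in> path_image loop"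
  using H(4)[OF w_in_U[OF that]] \<zeta>_nz by (simp add: Q_def w_def)

lemma Q_nz: "Q z \<noteq> 0" if "z \<in> w ` path_image loop"
  using that Q_w loop_nz H(2) w_in_U by auto

lemma Q_deriv: "(Q has_field_derivative of_nat N * z ^ (N - 1)) (at z)"
  unfolding Q_def by (auto intro!: derivative_eq_intros)

lemma contour_integrable_loop: "f contour_integrable_on loop" if "continuous_on (path_image loop) f"
  unfolding loop_def using that
  by (intro contour_integrable_joinI contour_integrable_continuous_linepath)
    (auto simp: path_image_loop intro: continuous_on_subset)

lemma integrable_T:
  "(\<lambda>s. R (w s) / H (w s)) contour_integrable_on loop" if "continuous_on (w ` path_image loop) R"
proof (rule contour_integrable_loop)
  have w: "continuous_on (path_image loop) w"
    unfolding w_def by (intro continuous_intros)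
  have "continuous_on (path_image loop) (\<lambda>s. R (w s))" "continuous_on (path_image loop) (\<lambda>s. H (w s))"
    using w_in_U by (auto intro!: continuous_on_compose2[OF that w]
      continuous_on_compose2[OF holomorphic_on_imp_continuous_on[OF H(1)] w])
  then show "continuous_on (path_image loop) (\<lambda>s. R (w s) / H (w s))"
    using H(2) w_in_U by (intro continuous_intros) auto
qed

text \<open>\<open>Q\<^bsup>1/2\<^esup> X\<close> is a primitive of \<open>R / Q\<^bsup>1/2\<^esup>\<close> and changes its sign along the loop.\<close>

lemma has_contour_integral_exact:
  assumes "\<And>z. z \<in> w ` path_image loop \<Longrightarrow> (X has_field_derivative X' z) (at z)"
    and "\<And>z. z \<in> w ` path_image loop \<Longrightarrow> Q z * X' z + of_nat N * z ^ (N - 1) * X z / 2 = R z"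
  shows "((\<lambda>s. R (w s) / H (w s)) has_contour_integral X 0 / \<zeta>) loop"
proof -
  \<comment> \<open>On the loop s H(w s) is the root of Q, so the function differentiated is Q^(1/2)
    X. Its z-derivative is R / Q^(1/2), and dz = -2 \<zeta> s ds cancels the s in the
    denominator.\<close>
  have d: "((\<lambda>s. s * (H (w s) * X (w s))) has_field_derivative (- 2 * \<zeta>) * (R (w s) / H (w s)))
      (at s within path_image loop)" if s: "s \<in> path_image loop" for s
  proof -
    let ?z = "w s"
    have dH: "(H has_field_derivative deriv H ?z) (at ?z)"
      using H(1) U(1) w_in_U[OF s] holomorphic_derivI by blast
    have dX: "(X has_field_derivative X' ?z) (at ?z)"
      using assms(1) s by blast
    have dw: "(w has_field_derivative - 2 * \<zeta> * s) (at s)"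
      unfolding w_def by (auto intro!: derivative_eq_intros)
    have "((\<lambda>s. s * (H (w s) * X (w s))) has_field_derivative
        1 * (H ?z * X ?z) + (deriv H ?z * (- 2 * \<zeta> * s) * X ?z + X' ?z * (- 2 * \<zeta> * s) * H ?z) * s) (at s)"
      by (rule DERIV_mult[OF DERIV_ident DERIV_mult[OF DERIV_chain2[OF dH dw] DERIV_chain2[OF dX dw]]])
    also have "1 * (H ?z * X ?z) + (deriv H ?z * (- 2 * \<zeta> * s) * X ?z + X' ?z * (- 2 * \<zeta> * s) * H ?z) * s
      = (- 2 * \<zeta>) * (R ?z / H ?z)"
    proof -
      have "((\<lambda>z. (1 - z / \<zeta>) * (H z)\<^sup>2) has_field_derivative
          (- (H ?z)\<^sup>2 / \<zeta> + 2 * (1 - ?z / \<zeta>) * H ?z * deriv H ?z)) (at ?z)"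
        using dH \<zeta>_nz by (auto intro!: derivative_eq_intros)
      then have "(Q has_field_derivative (- (H ?z)\<^sup>2 / \<zeta> + 2 * (1 - ?z / \<zeta>) * H ?z * deriv H ?z)) (at ?z)"
        by (rule has_field_derivative_transform_within_open[OF _ U(1) w_in_U[OF s]]) (simp add: H(4) Q_def)
      then have Q': "of_nat N * ?z ^ (N - 1) = - (H ?z)\<^sup>2 / \<zeta> + 2 * s\<^sup>2 * H ?z * deriv H ?z"
        using DERIV_unique[OF Q_deriv] \<zeta>_nz by (fastforce simp: w_def)
      have "R ?z = Q ?z * X' ?z + of_nat N * ?z ^ (N - 1) * X ?z / 2"
        using assms(2) s by simp
      then show ?thesis
        unfolding Q' Q_w[OF s] using H(2)[OF w_in_U[OF s]] \<zeta>_nz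
        by (simp add: field_simps power2_eq_square)
    qed
    finally show ?thesis
      by (rule has_field_derivative_at_within)
  qed
  \<comment> \<open>Both ends of the loop have w s = 0 and H = 1, while s is 1 at the start and -1
    at the finish. The boundary term is therefore -2 X 0.\<close>
  have "((\<lambda>s. (- 2 * \<zeta>) * (R (w s) / H (w s))) has_contour_integral
      pathfinish loop * (H (w (pathfinish loop)) * X (w (pathfinish loop))) -
      pathstart loop * (H (w (pathstart loop)) * X (w (pathstart loop)))) loop"
    by (rule contour_integral_primitive[OF d]) auto
  then have "((\<lambda>s. (- 2 * \<zeta>) * (R (w s) / H (w s))) has_contour_integral (- 2 * \<zeta>) * (X 0 / \<zeta>)) loop"
    using \<zeta>_nz by (simp add: w_def H(3))
  from has_contour_integral_lmul[OF this, of "inverse (- 2 * \<zeta>)"] show ?thesis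
    using \<zeta>_nz by (simp add: field_simps)
qed

text \<open>The equation is required on the image of the loop only, so X may be singular at \<zeta>.
  This admits negative powers of Q.\<close>

lemma T_exact:
  assumes "\<And>z. z \<in> w ` path_image loop \<Longrightarrow> (X has_field_derivative X' z) (at z)"
    and "\<And>z. z \<in> w ` path_image loop \<Longrightarrow> Q z * X' z + of_nat N * z ^ (N - 1) * X z / 2 = R z"
  shows "T R = X 0"
  using contour_integral_unique[OF has_contour_integral_exact[OF assms]] \<zeta>_nz
  by (simp add: T_def)

lemma T_add:
  assumes "continuous_on (w ` path_image loop) R" "continuous_on (w ` path_image loop) S"
  shows "T (\<lambda>z. R z + S z) = T R + T S"
  unfolding T_def using contour_integral_add[OF integrable_T[OF assms(1)] integrable_T[OF assms(2)]]
  by (simp add: add_divide_distrib distrib_left)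

lemma T_cmult: "T (\<lambda>z. c * R z) = c * T R" if "continuous_on (w ` path_image loop) R"
  unfolding T_def using contour_integral_lmul[OF integrable_T[OF that], of c] by simp

lemma T_cong: "T R = T S" if "\<And>z. z \<in> w ` path_image loop \<Longrightarrow> R z = S z"
  unfolding T_def using that by (auto intro!: contour_integral_cong)

text \<open>The loop counterpart of the integral of z^(L-1) Q^(m+1/2): \<open>T\<close> itself
  contributes the exponent -1/2, which leaves an integer power of Q, possibly negative.\<close>

definition \<tau> :: "nat \<Rightarrow> int \<Rightarrow> complex" where
  "\<tau> L m = T (\<lambda>z. z ^ (L - 1) * Q z powi (m + 1))"

lemma continuous_Q_powi [continuous_intros]:
  "continuous_on (w ` path_image loop) (\<lambda>z. Q z powi m)"
  using Q_nz by (intro continuous_on_power_int) (auto simp: Q_def intro!: continuous_intros)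

text \<open>This is \<open>T_exact\<close> for X = z^L Q^(m+1), which vanishes at 0 because L \<ge>
  1.\<close>

lemma \<tau>_shift:
  assumes "L \<ge> 1"
  shows "of_nat L * \<tau> L (m + 1) + (of_int m + 3/2) * of_nat N * \<tau> (L + N) m = 0"
proof -
  let ?R = "\<lambda>z. of_nat L * (z ^ (L - 1) * Q z powi (m + 2)) + (of_int m + 3/2) * of_nat N * (z ^ (L + N - 1) * Q z powi (m + 1))"
  have "T ?R = 0 ^ L * Q 0 powi (m + 1)"
  proof (rule T_exact)
    fix z assume z: "z \<in> w ` path_image loop"
    have nz: "Q z \<noteq> 0" using Q_nz[OF z] .
    show "((\<lambda>z. z ^ L * Q z powi (m + 1)) has_field_derivative
      of_nat L * z ^ (L - 1) * Q z powi (m + 1) + z ^ L * (of_int (m + 1) * Q z powi m * (of_nat N * z ^ (N - 1)))) (at z)"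
      using nz by (auto intro!: derivative_eq_intros Q_deriv)
    have p: "Q z powi (m + 1) = Q z * Q z powi m" "Q z powi (m + 2) = Q z * (Q z * Q z powi m)"
      using nz by (auto simp: power_int_add power2_eq_square)
    have q: "z ^ (L + N - 1) = z ^ L * z ^ (N - 1)"
      using N by (simp flip: power_add)
    show "Q z * (of_nat L * z ^ (L - 1) * Q z powi (m + 1) + z ^ L * (of_int (m + 1) * Q z powi m * (of_nat N * z ^ (N - 1))))
       + of_nat N * z ^ (N - 1) * (z ^ L * Q z powi (m + 1)) / 2 = ?R z"
      unfolding p q by (simp add: algebra_simps)
  qed
  moreover have "T ?R = of_nat L * \<tau> L (m + 1) + (of_int m + 3/2) * of_nat N * \<tau> (L + N) m"
    by (subst T_add, (intro continuous_intros)+, subst (1 2) T_cmult, (intro continuous_intros)+)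
      (simp add: \<tau>_def add.assoc)
  moreover have "(0::complex) ^ L = 0" using assms by simp
  ultimately show ?thesis by (simp only: mult_zero_left)
qed

text \<open>One factor Q is written as 1 + z^N. Combined with \<open>\<tau>_shift\<close> this
  eliminates the index L + N and leaves a recursion in m at fixed L.\<close>

lemma \<tau>_split:
  assumes "L \<ge> 1"
  shows "\<tau> (L + N) m = \<tau> L (m + 1) - \<tau> L m"
proof -
  have "\<tau> L (m + 1) = T (\<lambda>z. z ^ (L - 1) * Q z powi (m + 1) + z ^ (L + N - 1) * Q z powi (m + 1))"
    unfolding \<tau>_def
  proof (rule T_cong)
    fix z assume "z \<in> w ` path_image loop"
    then have "Q z \<noteq> 0" by (rule Q_nz)
    then have "Q z powi (m + 1 + 1) = Q z powi (m + 1) * (1 + z ^ N)"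
      by (subst power_int_add) (auto simp: Q_def)
    moreover have "z ^ (L + N - 1) = z ^ (L - 1) * z ^ N"
      using assms by (simp flip: power_add)
    ultimately show "z ^ (L - 1) * Q z powi (m + 1 + 1) = z ^ (L - 1) * Q z powi (m + 1) + z ^ (L + N - 1) * Q z powi (m + 1)"
      by (simp add: algebra_simps)
  qed
  also have "\<dots> = \<tau> L m + \<tau> (L + N) m"
    unfolding \<tau>_def by (subst T_add) (auto intro!: continuous_intros)
  finally show ?thesis by simp
qed

text \<open>Substitution u = t^N. The power L + N - 1 instead of L - 1 makes the exponent of u equal
  to L/N, so the Beta integrand is continuous at 0.\<close>

lemma Beta_power_integral:
  assumes "L \<ge> 1"
  shows "((\<lambda>t. real N * t ^ (L + N - 1) * sqrt (1 - t ^ N)) has_integral Beta (real L / real N + 1) (3/2)) {0..1}"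
proof -
  let ?f = "\<lambda>u::real. u powr (real L / real N + 1 - 1) * (1 - u) powr (3/2 - 1)"
  have i: "integral {0..1} ?f = Beta (real L / real N + 1) (3/2)"
    by (rule integral_unique[OF has_integral_Beta_real]) (auto simp: add_nonneg_pos)
  have "((\<lambda>t. (real N * t ^ (N - 1)) *\<^sub>R ?f (t ^ N)) has_integral (integral {0 ^ N..1 ^ N} ?f)) {0..1}"
  proof (rule has_integral_substitution[of 0 1 "\<lambda>t. t ^ N" 0 1])
    show "continuous_on {0..1} ?f"
      using N assms by (intro continuous_intros continuous_on_powr') auto
  qed (use N in \<open>auto simp: power_le_one intro!: derivative_eq_intros\<close>)
  also have "integral {0 ^ N..1 ^ N} ?f = Beta (real L / real N + 1) (3/2)"
    using i N by (simp add: power_0_left)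
  finally show ?thesis
  proof (rule has_integral_eq[rotated])
    fix t :: real assume t: "t \<in> {0..1}"
    have "(t ^ N) powr (real L / real N) = t ^ L" if "t \<noteq> 0"
      using t that N by (simp add: powr_powr flip: powr_realpow)
    then show "(real N * t ^ (N - 1)) *\<^sub>R ?f (t ^ N) = real N * t ^ (L + N - 1) * sqrt (1 - t ^ N)"
      using t N by (cases "t = 0") (auto simp: powr_half_sqrt power_le_one power_add[symmetric] power_0_left mult_ac)
  qed
qed

text \<open>The link between loop and segment: one E solves the equation of Q on all of U, \<zeta>
  included. The loop gives E 0 and the segment integral gives - E 0; the latter is a Beta integral.
  The factor \<zeta>^N = -1 cancels the sign.\<close>

lemma \<tau>_zero:
  assumes "L \<ge> 1"
  shows "\<tau> (L + N) 0 = \<zeta> ^ L / of_nat N * of_real (Beta (real L / real N + 1) (3/2))"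
proof -
  let ?f = "\<lambda>z. z ^ (L + N - 1) * Q z"
  have Qhol: "Q holomorphic_on U" and fhol: "?f holomorphic_on U"
    unfolding Q_def by (intro holomorphic_intros)+
  have dQ: "deriv Q z = of_nat N * z ^ (N - 1)" for z
    using DERIV_imp_deriv[OF Q_deriv] .
  have "Q \<zeta> = 0" "deriv Q \<zeta> \<noteq> 0" "\<And>z. z \<in> U \<Longrightarrow> Q z = 0 \<Longrightarrow> z = \<zeta>"
    using \<zeta> \<zeta>_nz N U(5) by (auto simp: dQ Q_def)
  then obtain E where E: "E holomorphic_on U" "\<And>z. z \<in> U \<Longrightarrow> Q z * deriv E z + deriv Q z * E z / 2 = ?f z"
    using singular_ode_solution[OF U(1,2) Qhol fhol U(4)] by blast
  have "T ?f = E 0"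
    using E U(1) w_in_U by (intro T_exact[where X' = "deriv E"]) (auto simp: dQ intro: holomorphic_derivI)
  then have \<tau>: "\<tau> (L + N) 0 = E 0"
    by (simp add: \<tau>_def)
  define p where "p t = complex_of_real (sqrt (1 - t ^ N))" for t
  have Ql: "Q (linepath 0 \<zeta> t) = of_real (1 - t ^ N)" for t
    by (simp add: Q_def linepath_def scaleR_conv_of_real power_mult_distrib \<zeta>)
  have "((\<lambda>t. ?f (linepath 0 \<zeta> t) / p t * vector_derivative (linepath 0 \<zeta>) (at t within {0..1})) has_integral
      - (1 * E (pathstart (linepath 0 \<zeta>)))) {0..1}"
  proof (rule has_integral_continued_sqrt[OF U(1) Qhol E])
    show "path_image (linepath 0 \<zeta>) \<subseteq> U"
      using closed_segment_subset[OF U(3,4,2)] by simp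
    show "continued_sqrt (\<lambda>t. Q (linepath 0 \<zeta> t)) 1 p"
      using N unfolding continued_sqrt_def p_def Ql
      by (auto intro!: continuous_intros simp: power_le_one power_0_left simp flip: of_real_power)
    show "Q (linepath 0 \<zeta> t) \<noteq> 0" if "t \<in> {0..<1}" for t
      using that N power_strict_mono[of t 1 N] unfolding Ql of_real_eq_0_iff by simp
  qed (use \<zeta> in \<open>simp_all add: Q_def del: linepath_0\<close>)
  moreover have "((\<lambda>t. \<zeta> ^ (L + N) / of_nat N * of_real (real N * t ^ (L + N - 1) * sqrt (1 - t ^ N))) has_integral
     \<zeta> ^ (L + N) / of_nat N * of_real (Beta (real L / real N + 1) (3/2))) {0..1}"
    by (intro has_integral_mult_right has_integral_of_real Beta_power_integral assms)
  moreover have eq: "?f (linepath 0 \<zeta> t) / p t * vector_derivative (linepath 0 \<zeta>) (at t within {0..1}) =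
      \<zeta> ^ (L + N) / of_nat N * of_real (real N * t ^ (L + N - 1) * sqrt (1 - t ^ N))" if t: "t \<in> {0..1}" for t
  proof -
    have "1 - t ^ N \<ge> 0" using t by (simp add: power_le_one)
    then have "complex_of_real (1 - t ^ N) / p t = of_real (sqrt (1 - t ^ N))"
      unfolding p_def of_real_divide[symmetric] by (simp only: real_div_sqrt)
    moreover have "(t *\<^sub>R \<zeta>) ^ (L + N - 1) * \<zeta> = \<zeta> ^ (L + N) * of_real (t ^ (L + N - 1))"
      using N by (cases "L + N") (auto simp: scaleR_conv_of_real power_mult_distrib)
    moreover have eq: "?f (linepath 0 \<zeta> t) / p t * vector_derivative (linepath 0 \<zeta>) (at t within {0..1}) =
       ((t *\<^sub>R \<zeta>) ^ (L + N - 1) * \<zeta>) * (complex_of_real (1 - t ^ N) / p t)"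
      using vector_derivative_linepath_within[of t 0 \<zeta>] t unfolding Ql
      by (simp add: linepath_def)
    ultimately have "?f (linepath 0 \<zeta> t) / p t * vector_derivative (linepath 0 \<zeta>) (at t within {0..1}) =
       \<zeta> ^ (L + N) * of_real (t ^ (L + N - 1)) * of_real (sqrt (1 - t ^ N))"
      by (simp only:)
    then show ?thesis
      using N by simp
  qed
  ultimately have "- E 0 = \<zeta> ^ (L + N) / of_nat N * of_real (Beta (real L / real N + 1) (3/2))"
    using has_integral_unique[OF has_integral_eq[OF eq]] by (simp only: mult_1_left pathstart_linepath)
  then show ?thesis
    by (simp add: \<tau> power_add \<zeta> minus_equation_iff)
qed

text \<open>
  The Beta integral is only used for \<open>m = 0\<close>, where the integrand is continuous; the recursion in \<open>m\<close>
  carries the value to the non-integrable exponents.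
\<close>

lemma \<tau>_Gamma:
  assumes "L \<ge> 1"
  shows "\<tau> L m = - (\<zeta> ^ L / of_nat N) * of_real (Gamma (real L / real N) * Gamma (real_of_int m + 3/2)
     * rGamma (real L / real N + real_of_int m + 3/2))"
proof -
  define c where "c = real L / real N"
  have c: "c > 0" "real L = c * real N" using assms N by (auto simp: c_def)
  define g where "g m = Gamma (real_of_int m + 3/2) * rGamma (c + real_of_int m + 3/2)" for m
  have nn: "real_of_int m + 3/2 \<noteq> 0" for m
  proof
    assume "real_of_int m + 3/2 = 0"
    then have "real_of_int (2 * m + 3) = 0" by simp
    then have "2 * m + 3 = 0" by (subst (asm) of_int_eq_0_iff)
    then show False by presburger
  qed
  have ni: "real_of_int m + 3/2 \<notin> \<int>\<^sub>\<le>\<^sub>0" for m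
  proof
    assume "real_of_int m + 3/2 \<in> \<int>\<^sub>\<le>\<^sub>0"
    then obtain k where "real_of_int m + 3/2 = real_of_int k" by (auto elim!: nonpos_Ints_cases)
    then show False using nn[of "m - k"] by simp
  qed
  have g: "(c + real_of_int m + 3/2) * g (m + 1) = (real_of_int m + 3/2) * g m" for m
  proof -
    have "Gamma (real_of_int m + 3/2 + 1) = (real_of_int m + 3/2) * Gamma (real_of_int m + 3/2)"
      using ni by (rule Gamma_plus1)
    moreover have "(c + real_of_int m + 3/2) * rGamma (c + real_of_int m + 3/2 + 1) = rGamma (c + real_of_int m + 3/2)"
      by (rule rGamma_plus1)
    ultimately show ?thesis
      by (simp add: g_def algebra_simps)
  qed
  have t: "of_real (c + real_of_int m + 3/2) * \<tau> L (m + 1) = of_real (real_of_int m + 3/2) * \<tau> L m" for m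
  proof -
    have "of_nat N * (of_real (c + real_of_int m + 3/2) * \<tau> L (m + 1) - of_real (real_of_int m + 3/2) * \<tau> L m) = 0"
      using \<tau>_shift[OF assms, of m] arg_cong[OF c(2), of complex_of_real] unfolding \<tau>_split[OF assms]
      by (simp add: algebra_simps)
    then show ?thesis using N by simp
  qed
  \<comment> \<open>Induction starts at m = 1 because \<open>\<tau>_shift\<close> with m = 0 ties
    \<open>\<tau> L 1\<close> to the known \<open>\<tau> (L + N) 0\<close>. Going up one divides by
    c + i + 3/2 > 0. Going down one divides by m + 3/2, which is never 0; the factor c + m + 3/2 may
    vanish there, which the reciprocal Gamma function accommodates.\<close>
  have "\<tau> L m = - (\<zeta> ^ L / of_nat N) * of_real (Gamma c * g m)"
  proof (induction m rule: int_induct[where k = 1])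
    case base
    have "Gamma (5/2 :: real) = 3/2 * Gamma (3/2)"
      using Gamma_plus1[OF ni[of 0]] by simp
    moreover have "Gamma (c + 1) = c * Gamma c"
      using c(1) by (intro Gamma_plus1) (auto elim!: nonpos_Ints_cases)
    moreover have "Beta (c + 1) (3/2) = Gamma (c + 1) * Gamma (3/2) * rGamma (c + 5/2)"
      by (simp add: Beta_altdef add.assoc)
    moreover have "g 1 = Gamma (5/2) * rGamma (c + 5/2)"
      by (simp add: g_def add.commute)
    ultimately have B: "3/2 * Beta (c + 1) (3/2) = c * Gamma c * g 1"
      by (simp only: mult_ac)
    have "of_nat L * \<tau> L 1 = - (3/2) * of_nat N * (\<zeta> ^ L / of_nat N * of_real (Beta (c + 1) (3/2)))"
      using \<tau>_shift[OF assms, of 0] \<tau>_zero[OF assms] by (simp add: c_def eq_neg_iff_add_eq_0)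
    also have "\<dots> = - (\<zeta> ^ L * of_real (3/2 * Beta (c + 1) (3/2)))"
      using N by simp
    finally have "of_nat L * \<tau> L 1 = - (\<zeta> ^ L * of_real (c * Gamma c * g 1))"
      unfolding B .
    moreover have "of_nat L = of_real c * complex_of_nat N"
      using arg_cong[OF c(2), of complex_of_real] by simp
    ultimately have "complex_of_real c * (of_nat N * \<tau> L 1 + \<zeta> ^ L * of_real (Gamma c * g 1)) = 0"
      by (simp add: algebra_simps)
    then have "of_nat N * \<tau> L 1 + \<zeta> ^ L * of_real (Gamma c * g 1) = 0"
      using c(1) unfolding mult_eq_0_iff by simp
    then show ?case
      using N by (simp add: eq_neg_iff_add_eq_0 field_simps)
  next
    case (step1 i)
    define a where "a = c + real_of_int i + 3/2"
    have "a > 0" using step1 c by (simp add: a_def)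
    have "of_real a * \<tau> L (i + 1) = - (\<zeta> ^ L / of_nat N) * of_real (Gamma c * (a * g (i + 1)))"
      unfolding a_def g[of i] t[of i] step1.IH by simp
    also have "\<dots> = of_real a * (- (\<zeta> ^ L / of_nat N) * of_real (Gamma c * g (i + 1)))"
      by simp
    finally show ?case
      using \<open>a > 0\<close> by (subst (asm) mult_left_cancel) auto
  next
    case (step2 i)
    define a where "a = real_of_int (i - 1) + 3/2"
    have "a \<noteq> 0" using nn[of "i - 1"] by (simp add: a_def)
    have "of_real a * \<tau> L (i - 1) = - (\<zeta> ^ L / of_nat N) * of_real (Gamma c * ((c + real_of_int (i - 1) + 3/2) * g (i - 1 + 1)))"
      unfolding a_def t[of "i - 1", symmetric] using step2.IH by simp
    also have "\<dots> = of_real a * (- (\<zeta> ^ L / of_nat N) * of_real (Gamma c * g (i - 1)))"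
      unfolding g[of "i - 1"] a_def by simp
    finally show ?case
      using \<open>a \<noteq> 0\<close> by (subst (asm) mult_left_cancel) auto
  qed
  then show ?thesis
    by (simp add: g_def c_def mult.assoc)
qed

text \<open>1 / H is bounded on the compact loop, so a summable majorant for the functions is, up to
  a constant, one for the integrands of \<open>T\<close>.\<close>

lemma T_has_sum:
  assumes "\<And>i z. i \<in> I \<Longrightarrow> z \<in> w ` path_image loop \<Longrightarrow> norm (f i z) \<le> B i" "B summable_on I"
    and "\<And>z. z \<in> w ` path_image loop \<Longrightarrow> ((\<lambda>i. f i z) has_sum g z) I"
    and "\<And>i. i \<in> I \<Longrightarrow> continuous_on (w ` path_image loop) (f i)"
  shows "((\<lambda>i. T (f i)) has_sum T g) I"
proof -
  let ?F = "\<lambda>R s. R (w s) / H (w s)"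
  have wc: "continuous_on (path_image loop) w"
    unfolding w_def by (intro continuous_intros)
  have "continuous_on (path_image loop) (\<lambda>s. inverse (H (w s)))"
    using H(2) w_in_U
    by (auto intro!: continuous_intros continuous_on_compose2[OF holomorphic_on_imp_continuous_on[OF H(1)] wc])
  then have "bounded ((\<lambda>s. inverse (H (w s))) ` path_image loop)"
    using valid_path_imp_path[OF loop_simps(3)]
    by (intro compact_imp_bounded compact_continuous_image compact_path_image)
  then obtain h where h: "\<And>s. s \<in> path_image loop \<Longrightarrow> norm (inverse (H (w s))) \<le> h"
    unfolding bounded_iff by blast
  \<comment> \<open>The exchange of sum and integral asks for a bound on the path's derivative at
    every parameter. It is applied to the two straight pieces, which have no corner.\<close>
  have seg: "((\<lambda>i. contour_integral (linepath a b) (?F (f i))) has_sum contour_integral (linepath a b) (?F g)) I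
      \<and> ?F g contour_integrable_on linepath a b"
    if ab: "closed_segment a b \<subseteq> path_image loop" for a b
  proof -
    have "norm (?F (f i) s) \<le> B i * h" if "i \<in> I" "s \<in> path_image (linepath a b)" for i s
      using that ab assms(1)[OF \<open>i \<in> I\<close>, of "w s"] h[of s]
      unfolding divide_inverse norm_mult by (intro mult_mono) (auto intro: order_trans[OF norm_ge_zero])
    moreover have "((\<lambda>i. ?F (f i) s) has_sum ?F g s) I" if "s \<in> path_image (linepath a b)" for s
      unfolding divide_inverse using that ab by (intro has_sum_cmult_left assms(3)) auto
    moreover have "?F (f i) contour_integrable_on linepath a b" if "i \<in> I" for i
    proof (rule contour_integrable_continuous_linepath)
      have "continuous_on (path_image loop) (\<lambda>s. f i (w s))" "continuous_on (path_image loop) (\<lambda>s. H (w s))"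
        using w_in_U by (auto intro!: continuous_on_compose2[OF assms(4)[OF that] wc]
            continuous_on_compose2[OF holomorphic_on_imp_continuous_on[OF H(1)] wc])
      then have "continuous_on (path_image loop) (?F (f i))"
        using H(2) w_in_U by (intro continuous_intros) auto
      then show "continuous_on (closed_segment a b) (?F (f i))"
        using ab by (rule continuous_on_subset)
    qed
    moreover have "norm (vector_derivative (linepath a b) (at t)) \<le> norm (b - a)" for t
      by simp
    ultimately show ?thesis
      using has_sum_contour_integral[of I "linepath a b" "\<lambda>i. ?F (f i)" "\<lambda>i. B i * h" "?F g" "norm (b - a)"]
        summable_on_cmult_left[OF assms(2)] by auto
  qed
  have split: "contour_integral loop (?F R) = contour_integral (linepath 1 (\<i> * of_real \<delta>)) (?F R)
      + contour_integral (linepath (\<i> * of_real \<delta>) (-1)) (?F R)"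
    if "?F R contour_integrable_on linepath 1 (\<i> * of_real \<delta>)" "?F R contour_integrable_on linepath (\<i> * of_real \<delta>) (-1)" for R
    unfolding loop_def using that by (intro contour_integral_join) auto
  have int_f: "?F (f i) contour_integrable_on linepath 1 (\<i> * of_real \<delta>)" "?F (f i) contour_integrable_on linepath (\<i> * of_real \<delta>) (-1)"
    if "i \<in> I" for i
    using integrable_T[OF assms(4)[OF that]] contour_integrable_joinD1 contour_integrable_joinD2
    unfolding loop_def by blast+
  note s1 = seg[of 1 "\<i> * of_real \<delta>"] and s2 = seg[of "\<i> * of_real \<delta>" "-1"]
  have "((\<lambda>i. contour_integral (linepath 1 (\<i> * of_real \<delta>)) (?F (f i)) + contour_integral (linepath (\<i> * of_real \<delta>) (-1)) (?F (f i)))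
     has_sum contour_integral (linepath 1 (\<i> * of_real \<delta>)) (?F g) + contour_integral (linepath (\<i> * of_real \<delta>) (-1)) (?F g)) I"
    using s1 s2 by (intro has_sum_add) (auto simp: path_image_loop)
  also have "?this \<longleftrightarrow> ((\<lambda>i. contour_integral loop (?F (f i))) has_sum contour_integral loop (?F g)) I"
    using s1 s2 int_f by (subst split) (auto simp: path_image_loop split intro!: has_sum_cong)
  finally show ?thesis
    unfolding T_def by (rule has_sum_cmult_right)
qed

end

subsection \<open>Expansion on the loop\<close>

lemma gbinomial_Suc_right:
  fixes a :: "'a::field_char_0"
  shows "a gchoose Suc n = (a gchoose n) * (a - of_nat n) / of_nat (Suc n)"
  by (simp add: gbinomial_prod_rev)

text \<open>For k = 0 consecutive coefficients have a ratio of modulus at most 1; Pascal's rule then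
  at most doubles the bound with each k. The growth 2^k is later offset by the power of v /
  2.\<close>

lemma norm_gbinomial_half_le: "norm ((of_nat k + 1/2 :: complex) gchoose M) \<le> 2 ^ k"
proof (induction k arbitrary: M)
  case 0
  show ?case
  proof (induction M)
    case (Suc M)
    have "norm (1/2 - of_nat M :: complex) \<le> real (Suc M)"
      using norm_triangle_ineq4[of "1/2 :: complex" "of_nat M"] by simp
    then have "norm ((1/2 :: complex) gchoose M) * norm (1/2 - of_nat M :: complex) \<le> 1 * real (Suc M)"
      using Suc.IH by (intro mult_mono) auto
    then show ?case
      by (simp add: gbinomial_Suc_right norm_mult norm_divide divide_le_eq del: of_nat_Suc)
  qed simp
next
  case (Suc k)
  show ?case
  proof (cases M)
    case 0
    then show ?thesis using one_le_power[of "2 :: real" "Suc k"] by simp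
  next
    case (Suc m)
    have "(of_nat (Suc k) + 1/2 :: complex) = (of_nat k + 1/2) + 1" by simp
    then have "((of_nat (Suc k) + 1/2 :: complex) gchoose M) = ((of_nat k + 1/2) gchoose m) + ((of_nat k + 1/2) gchoose M)"
      unfolding Suc by (simp only: gbinomial_Suc_Suc)
    also have "norm \<dots> \<le> 2 ^ k + 2 ^ k"
      by (rule order_trans[OF norm_triangle_ineq add_mono]) (rule Suc.IH)+
    finally show ?thesis by simp
  qed
qed

lemma norm_gbinomial_minus_half_le: "norm ((- (1/2) :: complex) gchoose k) \<le> 1"
proof (induction k)
  case (Suc k)
  have "norm (- (1/2) - of_nat k :: complex) \<le> real (Suc k)"
    using norm_triangle_ineq4[of "- (1/2) :: complex" "of_nat k"] by simp
  then have "norm ((- (1/2) :: complex) gchoose k) * norm (- (1/2) - of_nat k :: complex) \<le> 1 * real (Suc k)"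
    using Suc.IH by (intro mult_mono) auto
  then show ?case
    by (simp add: gbinomial_Suc_right norm_mult norm_divide divide_le_eq del: of_nat_Suc)
qed simp

lemma inverse_csqrt_series:
  fixes x :: complex
  assumes "norm x < 1"
  shows "(\<lambda>k. ((- (1/2)) gchoose k) * (-1) ^ k * x ^ k) sums (1 / csqrt (1 - x))"
proof -
  have nz: "1 - x \<noteq> 0" using assms by auto
  have "(\<lambda>k. ((- (1/2)) gchoose k) * (- x) ^ k) sums (1 + - x) powr (- (1/2))"
    by (rule gen_binomial_complex) (use assms in simp)
  also have "(1 + - x) powr (- (1/2)) = 1 / csqrt (1 - x)"
    using nz by (simp add: powr_minus_divide csqrt_conv_powr)
  finally show ?thesis by (simp only: power_minus[of x] mult.assoc)
qed

lemma csqrt_odd_power_series: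
  fixes x :: complex
  assumes "norm x < 1"
  shows "(\<lambda>M. ((of_nat k + 1/2) gchoose M) * (-1) ^ M * x ^ M) sums (csqrt (1 - x) ^ (2 * k + 1))"
proof -
  have nz: "1 - x \<noteq> 0" using assms by auto
  have "(\<lambda>M. ((of_nat k + 1/2) gchoose M) * (- x) ^ M) sums (1 + - x) powr (of_nat k + 1/2)"
    by (rule gen_binomial_complex) (use assms in simp)
  also have "(1 + - x) powr (of_nat k + 1/2) = csqrt (1 - x) ^ (2 * k + 1)"
  proof -
    have "csqrt (1 - x) ^ (2 * k + 1) = (1 - x) ^ k * csqrt (1 - x)"
      by (simp add: power_mult)
    then show ?thesis
      using nz by (simp add: powr_add csqrt_conv_powr[symmetric] powr_nat)
  qed
  finally show ?thesis by (simp only: power_minus[of x] mult.assoc)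
qed

text \<open>On the loop |Q| \<ge> m, so \<open>vs_small\<close> gives |q / Q| \<le> 1/4 there, the
  weights 2^n coming from |z| \<le> 2. Likewise |P| \<le> 2^N + 1 + 1 on U, so
  \<open>v_small\<close> gives |v P / 2| \<le> 1/4 on U, and both binomial series converge
  geometrically.\<close>

locale perturbed = half_loop +
  fixes v :: complex and vs :: "nat \<Rightarrow> complex" and m :: real
  assumes m: "0 < m" "m \<le> 1" "\<And>z. z \<in> w ` path_image loop \<Longrightarrow> m \<le> norm (Q z)"
    and U_le: "\<And>z. z \<in> U \<Longrightarrow> norm z \<le> 2"
    and vs_small: "(\<Sum>n=1..N-2. norm (vs n) * 2 ^ n) \<le> m / 4"
    and v_small: "norm v * (2 ^ N + 2) \<le> 1/2"
begin

abbreviation "\<Gamma> \<equiv> w ` path_image loop"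

abbreviation "P \<equiv> sw_P N vs"

definition r :: "complex \<Rightarrow> complex" where "r z = (\<Sum>n=1..N-2. vs n * z ^ n / Q z)"

text \<open>The root of P / Q on the loop, not the loop parameter. There |r| \<le> 1/4 keeps 1 - r
  off the cut of the principal branch.\<close>

definition s :: "complex \<Rightarrow> complex" where "s z = csqrt (1 - r z)"

lemma \<Gamma>_U: "z \<in> \<Gamma> \<Longrightarrow> z \<in> U"
  using w_in_U by auto

lemma compact_\<Gamma>: "compact \<Gamma>"
  unfolding w_def using valid_path_imp_path[OF loop_simps(3)]
  by (intro compact_continuous_image compact_path_image continuous_intros) auto

lemma norm_q_le: "(\<Sum>n=1..N-2. norm (vs n * z ^ n)) \<le> m / 4" if "z \<in> U"
proof -
  have "(\<Sum>n=1..N-2. norm (vs n * z ^ n)) \<le> (\<Sum>n=1..N-2. norm (vs n) * 2 ^ n)"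
    using U_le[OF that] by (intro sum_mono) (auto simp: norm_mult norm_power intro!: mult_left_mono power_mono)
  then show ?thesis using vs_small by simp
qed

lemma norm_P_le: "norm (P z) \<le> 2 ^ N + 2" if "z \<in> U"
proof -
  have "norm (P z) \<le> norm (z ^ N) + norm (\<Sum>n=1..N-2. vs n * z ^ n) + 1"
    unfolding sw_P_def by (metis norm_one norm_triangle_mono norm_triangle_ineq4 order_refl)
  also have "norm (z ^ N) \<le> 2 ^ N"
    using U_le[OF that] by (simp add: norm_power power_mono)
  also have "norm (\<Sum>n=1..N-2. vs n * z ^ n) \<le> 1"
    using order_trans[OF norm_sum norm_q_le[OF that]] m by simp
  finally show ?thesis by simp
qed

lemma norm_Q_le: "norm (Q z) \<le> 2 ^ N + 2" if "z \<in> U"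
proof -
  have "norm (Q z) \<le> 1 + norm (z ^ N)"
    unfolding Q_def by (metis norm_one norm_triangle_ineq)
  also have "norm (z ^ N) \<le> 2 ^ N"
    using U_le[OF that] by (simp add: norm_power power_mono)
  finally show ?thesis by simp
qed

lemma norm_vP_le: "norm (v / 2 * P z) \<le> 1/4" if "z \<in> U"
proof -
  have "norm v * norm (P z) \<le> norm v * (2 ^ N + 2)"
    using norm_P_le[OF that] by (intro mult_left_mono) auto
  then show ?thesis using v_small by (simp add: norm_mult)
qed

lemma norm_r_terms_le: "(\<Sum>n=1..N-2. norm (vs n * z ^ n / Q z)) \<le> 1/4" if "z \<in> \<Gamma>"
proof -
  have "(\<Sum>n=1..N-2. norm (vs n * z ^ n / Q z)) = (\<Sum>n=1..N-2. norm (vs n * z ^ n)) / norm (Q z)"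
    by (simp add: norm_divide sum_divide_distrib)
  also have "\<dots> \<le> (m / 4) / m"
    using norm_q_le[OF \<Gamma>_U[OF that]] m(1) m(3)[OF that] by (intro frac_le) (auto intro: sum_nonneg)
  finally show ?thesis using m(1) by simp
qed

lemma norm_r_le: "norm (r z) \<le> 1/4" if "z \<in> \<Gamma>"
  unfolding r_def by (rule order_trans[OF norm_sum norm_r_terms_le[OF that]])

lemma P_eq_if: "P z = Q z * (1 - r z)" if "Q z \<noteq> 0"
proof -
  have "Q z * r z = (\<Sum>n=1..N-2. vs n * z ^ n)"
    using that by (simp add: r_def flip: sum_divide_distrib)
  then show ?thesis
    by (simp add: sw_P_def right_diff_distrib) (simp add: Q_def)
qed

lemma P_eq: "z \<in> \<Gamma> \<Longrightarrow> P z = Q z * (1 - r z)"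
  by (rule P_eq_if[OF Q_nz])

lemma s_square: "(s z)\<^sup>2 = 1 - r z"
  by (simp add: s_def)

lemma s_nz: "s z \<noteq> 0" if "z \<in> \<Gamma>"
proof
  assume "s z = 0"
  then have "r z = 1" by (simp add: s_def)
  then show False using norm_r_le[OF that] by simp
qed

lemma P_deriv: "(P has_field_derivative deriv P z) (at z)"
proof -
  have "P field_differentiable at z"
    unfolding sw_P_def by (intro derivative_intros)
  then show ?thesis by (rule DERIV_deriv_iff_field_differentiable[THEN iffD2])
qed

lemma r_deriv: "(r has_field_derivative deriv r z) (at z)" if "z \<in> \<Gamma>"
proof -
  have "r field_differentiable at z"
    unfolding r_def Q_def using Q_nz[OF that]
    by (intro derivative_intros) (auto simp: Q_def)
  then show ?thesis by (rule DERIV_deriv_iff_field_differentiable[THEN iffD2])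
qed

lemma s_deriv: "(s has_field_derivative - deriv r z / (2 * s z)) (at z)" if "z \<in> \<Gamma>"
proof -
  have "Re (r z) \<le> 1/4"
    using norm_r_le[OF that] complex_Re_le_cmod order_trans by blast
  then have "1 - r z \<notin> \<real>\<^sub>\<le>\<^sub>0"
    by (auto simp: complex_nonpos_Reals_iff)
  then show ?thesis
    unfolding s_def by (auto intro!: derivative_eq_intros r_deriv[OF that] simp: field_simps)
qed

lemma deriv_P_eq: "deriv P z = of_nat N * z ^ (N - 1) * (s z)\<^sup>2 - Q z * deriv r z" if "z \<in> \<Gamma>"
proof -
  have Qnz: "Q z \<noteq> 0" using Q_nz[OF that] .
  have "continuous_on UNIV Q" unfolding Q_def by (intro continuous_intros)
  then have S: "open {x. Q x \<noteq> 0}" "z \<in> {x. Q x \<noteq> 0}"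
    using Qnz by (auto intro!: open_Collect_neq)
  have eq: "Q x * (1 - r x) = P x" if "x \<in> {x. Q x \<noteq> 0}" for x
    using P_eq_if[of x] that by simp
  have "((\<lambda>x. Q x * (1 - r x)) has_field_derivative of_nat N * z ^ (N - 1) * (s z)\<^sup>2 - Q z * deriv r z) (at z)"
    unfolding s_square by (auto intro!: derivative_eq_intros Q_deriv r_deriv[OF that])
  then have "(P has_field_derivative of_nat N * z ^ (N - 1) * (s z)\<^sup>2 - Q z * deriv r z) (at z)"
    by (rule has_field_derivative_transform_within_open[OF _ S(1,2) eq])
  then show ?thesis by (rule DERIV_imp_deriv)
qed

lemma continuous_s [continuous_intros]: "continuous_on \<Gamma> s"
  using DERIV_isCont[OF s_deriv] by (intro continuous_at_imp_continuous_on) auto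

lemma continuous_Q [continuous_intros]: "continuous_on A Q"
  unfolding Q_def by (intro continuous_intros)

lemma continuous_P [continuous_intros]: "continuous_on A P" 
  unfolding sw_P_def by (intro continuous_intros)

lemma continuous_deriv_P [continuous_intros]: "continuous_on A (deriv P)" 
proof -
  have "P holomorphic_on UNIV" using P_deriv holomorphic_on_open by blast
  then have "deriv P holomorphic_on UNIV" by (rule holomorphic_deriv) simp
  then show ?thesis using holomorphic_on_imp_continuous_on holomorphic_on_subset by blast
qed

text \<open>Since Q^(1/2) s E = P^(1/2) E, the product E s satisfies on the loop the equation of Q
  with right-hand side f / s. All terms of r contain a positive power of z, so s 0 = 1 and the value
  at 0 is not changed.\<close>

lemma T_ode_solution:
  assumes E: "E holomorphic_on U" "\<And>z. z \<in> U \<Longrightarrow> P z * deriv E z + deriv P z * E z / 2 = f z"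
  shows "T (\<lambda>z. f z / s z) = E 0"
proof -
  have "T (\<lambda>z. f z / s z) = E 0 * s 0"
  proof (rule T_exact)
    fix z assume z: "z \<in> \<Gamma>"
    note nz = s_nz[OF z]
    have dE: "(E has_field_derivative deriv E z) (at z)"
      using E(1) U(1) \<Gamma>_U[OF z] holomorphic_derivI by blast
    show "((\<lambda>z. E z * s z) has_field_derivative deriv E z * s z + E z * (- deriv r z / (2 * s z))) (at z)"
      by (auto intro!: derivative_eq_intros dE s_deriv[OF z])
    have "Q z * (deriv E z * s z + E z * (- deriv r z / (2 * s z))) + of_nat N * z ^ (N - 1) * (E z * s z) / 2
      = (Q z * (s z)\<^sup>2 * deriv E z + (of_nat N * z ^ (N - 1) * (s z)\<^sup>2 - Q z * deriv r z) * E z / 2) / s z"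
      using nz by (simp add: divide_simps) (simp add: algebra_simps power2_eq_square)
    also have "\<dots> = f z / s z"
      using E(2)[OF \<Gamma>_U[OF z]] by (simp add: deriv_P_eq[OF z] P_eq[OF z] s_square)
    finally show "Q z * (deriv E z * s z + E z * (- deriv r z / (2 * s z))) +
         of_nat N * z ^ (N - 1) * (E z * s z) / 2 = f z / s z" .
  qed
  also have "s 0 = 1"
    by (simp add: s_def r_def)
  finally show ?thesis by simp
qed

text \<open>\<open>T\<close> annihilates the total derivative of \<open>z P\<^bsup>k+1/2\<^esup>\<close>, which vanishes at \<open>0\<close>.\<close>

lemma T_by_parts:
  "T (\<lambda>z. z * deriv P z * P z ^ k / s z) = - T (\<lambda>z. Q z ^ (k + 1) * s z ^ (2 * k + 1)) / (of_nat k + 1/2)"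
proof -
  let ?R = "\<lambda>z. Q z ^ (k + 1) * s z ^ (2 * k + 1) + (of_nat k + 1/2) * (z * deriv P z * P z ^ k / s z)"
  have "T ?R = 0 * Q 0 ^ k * s 0 ^ (2 * k + 1)"
  proof (rule T_exact)
    fix z assume z: "z \<in> \<Gamma>"
    note nz = s_nz[OF z] and Qnz = Q_nz[OF z]
    let ?Q' = "of_nat N * z ^ (N - 1)" and ?s' = "- deriv r z / (2 * s z)"
    show "((\<lambda>z. z * Q z ^ k * s z ^ (2 * k + 1)) has_field_derivative
      Q z ^ k * s z ^ (2 * k + 1) + z * (of_nat k * Q z ^ (k - 1) * ?Q') * s z ^ (2 * k + 1)
       + z * Q z ^ k * (of_nat (2 * k + 1) * s z ^ (2 * k) * ?s')) (at z)"
      by (rule derivative_eq_intros Q_deriv s_deriv[OF z] refl)+ (use nz in \<open>simp add: divide_simps\<close>, simp add: algebra_simps)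
    \<comment> \<open>For k = 0 the truncated exponent k - 1 is harmless because of the factor
      \<open>of_nat k\<close>.\<close>
    have k: "of_nat k * Q z ^ (k - 1) * Q z = of_nat k * Q z ^ k"
      by (cases k) auto
    have "Q z * (Q z ^ k * s z ^ (2 * k + 1) + z * (of_nat k * Q z ^ (k - 1) * ?Q') * s z ^ (2 * k + 1)
       + z * Q z ^ k * (of_nat (2 * k + 1) * s z ^ (2 * k) * ?s')) + ?Q' * (z * Q z ^ k * s z ^ (2 * k + 1)) / 2
      = Q z ^ (k + 1) * s z ^ (2 * k + 1) + z * ?Q' * s z ^ (2 * k + 1) * (of_nat k * Q z ^ (k - 1) * Q z)
       + z * Q z * Q z ^ k * (of_nat (2 * k + 1) * s z ^ (2 * k) * ?s') + ?Q' * (z * Q z ^ k * s z ^ (2 * k + 1)) / 2"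
      by (simp add: algebra_simps)
    also have "\<dots> = ?R z"
      unfolding k deriv_P_eq[OF z] P_eq[OF z] s_square[symmetric] power_mult_distrib power_mult[symmetric]
      using nz by (simp add: divide_simps) (simp add: algebra_simps power2_eq_square)
    finally show "Q z * (Q z ^ k * s z ^ (2 * k + 1) + z * (of_nat k * Q z ^ (k - 1) * ?Q') * s z ^ (2 * k + 1)
       + z * Q z ^ k * (of_nat (2 * k + 1) * s z ^ (2 * k) * ?s')) + ?Q' * (z * Q z ^ k * s z ^ (2 * k + 1)) / 2 = ?R z" .
  qed
  moreover have "T ?R = T (\<lambda>z. Q z ^ (k + 1) * s z ^ (2 * k + 1)) + (of_nat k + 1/2) * T (\<lambda>z. z * deriv P z * P z ^ k / s z)"
  proof -
    have c: "continuous_on \<Gamma> (\<lambda>z. z * deriv P z * P z ^ k / s z)"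
      using s_nz by (intro continuous_intros) auto
    show ?thesis
      unfolding T_cmult[OF c, symmetric] by (rule T_add) (intro continuous_intros c)+
  qed
  moreover have "of_nat k + 1/2 \<noteq> (0 :: complex)"
  proof -
    have "Re (of_nat k + 1/2 :: complex) > 0" by simp
    then show ?thesis by force
  qed
  ultimately show ?thesis
    by (simp add: field_simps eq_neg_iff_add_eq_0)
qed

section \<open>Coefficients, terms and majorants of the double series\<close>

definition inv_sqrt_coeff :: "nat \<Rightarrow> complex" where
  "inv_sqrt_coeff k = ((- (1/2)) gchoose k) * (-1) ^ k"

text \<open>M! times the coefficient of x^M in (1 - x)^(k+1/2); the factorial matches the divided
  form 1 / (l_1! ... l_(N-2)!) of the multinomial terms.\<close>

definition half_power_coeff :: "nat \<Rightarrow> nat \<Rightarrow> complex" where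
  "half_power_coeff k M = ((of_nat k + 1/2) gchoose M) * (-1) ^ M * fact M"

text \<open>The coefficient of P^k in (1 - v P / 2)^(-1/2), divided by the k + 1/2 from the
  integration by parts.\<close>

definition outer_coeff :: "nat \<Rightarrow> complex" where
  "outer_coeff k = inv_sqrt_coeff k * (v / 2) ^ k / (of_nat k + 1/2)"

lemma norm_inv_sqrt_coeff_le: "norm (inv_sqrt_coeff k) \<le> 1"
  using norm_gbinomial_minus_half_le[of k] by (simp add: inv_sqrt_coeff_def norm_mult norm_power)

lemma norm_half_power_coeff_le: "norm (half_power_coeff k M) / fact M \<le> 2 ^ k"
  using norm_gbinomial_half_le[of k M] by (simp add: half_power_coeff_def norm_mult norm_power)

lemma norm_outer_coeff_le: "norm (outer_coeff k) \<le> 2 * (norm v / 2) ^ k"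
proof -
  have "Re (of_nat k + 1/2 :: complex) \<le> norm (of_nat k + 1/2 :: complex)"
    by (rule complex_Re_le_cmod)
  then have "1/2 \<le> norm (of_nat k + 1/2 :: complex)" by simp
  then have "norm (inv_sqrt_coeff k) * (norm v / 2) ^ k / norm (of_nat k + 1/2 :: complex) \<le> 1 * (norm v / 2) ^ k / (1/2)"
    using norm_inv_sqrt_coeff_le[of k] by (intro frac_le mult_mono) auto
  then show ?thesis
    by (simp add: outer_coeff_def norm_mult norm_divide norm_power)
qed

text \<open>Expansion of (1 - v P / 2)^(-1/2), with majorant a multiple of 4^(-k) on the loop;
  \<open>T_by_parts\<close> then replaces each term by a power of P free of P'.\<close>

lemma T_inverse_csqrt_series:
  "((\<lambda>k. - T (\<lambda>z. outer_coeff k * (Q z ^ (k + 1) * s z ^ (2 * k + 1)))) has_sum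
     T (\<lambda>z. z * deriv P z / csqrt (1 - v / 2 * P z) / s z)) UNIV"
proof -
  let ?g = "\<lambda>z. z * deriv P z / s z"
  have gc: "continuous_on \<Gamma> ?g"
    using s_nz by (intro continuous_intros) auto
  then have "bounded (?g ` \<Gamma>)"
    using compact_\<Gamma> compact_continuous_image compact_imp_bounded by blast
  then obtain C where C: "\<And>z. z \<in> \<Gamma> \<Longrightarrow> norm (?g z) \<le> C"
    unfolding bounded_iff by blast
  have "((\<lambda>k. T (\<lambda>z. ?g z * (inv_sqrt_coeff k * (v / 2 * P z) ^ k))) has_sum T (\<lambda>z. ?g z * (1 / csqrt (1 - v / 2 * P z)))) UNIV"
  proof (rule T_has_sum)
    fix z assume z: "z \<in> \<Gamma>"
    have vP: "norm (v / 2 * P z) \<le> 1/4" using norm_vP_le[OF \<Gamma>_U[OF z]] .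
    have b: "norm (inv_sqrt_coeff k * (v / 2 * P z) ^ k) \<le> (1/4) ^ k" for k
    proof -
      have "norm (inv_sqrt_coeff k) * norm (v / 2 * P z) ^ k \<le> 1 * (1/4) ^ k"
        using vP norm_inv_sqrt_coeff_le by (intro mult_mono power_mono) auto
      then show ?thesis by (simp only: norm_mult norm_power mult_1_left)
    qed
    show "norm (?g z * (inv_sqrt_coeff k * (v / 2 * P z) ^ k)) \<le> C * (1/4) ^ k" for k
      unfolding norm_mult[of "?g z"] using C[OF z] b by (intro mult_mono) (auto intro: order_trans[OF norm_ge_zero])
    have "summable (\<lambda>k. norm (inv_sqrt_coeff k * (v / 2 * P z) ^ k))"
      by (rule summable_comparison_test[OF _ summable_geometric[of "1/4 :: real"]]) (use b in auto)
    moreover have "(\<lambda>k. inv_sqrt_coeff k * (v / 2 * P z) ^ k) sums (1 / csqrt (1 - v / 2 * P z))"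
      unfolding inv_sqrt_coeff_def by (rule inverse_csqrt_series) (use vP in simp)
    ultimately show "((\<lambda>k. ?g z * (inv_sqrt_coeff k * (v / 2 * P z) ^ k)) has_sum ?g z * (1 / csqrt (1 - v / 2 * P z))) UNIV"
      by (intro has_sum_cmult_right norm_summable_imp_has_sum)
  next
    show "(\<lambda>k. C * (1/4) ^ k) summable_on (UNIV :: nat set)"
      by (intro summable_on_cmult_right) (auto intro!: norm_summable_imp_summable_on summable_geometric)
    show "continuous_on \<Gamma> (\<lambda>z. ?g z * (inv_sqrt_coeff k * (v / 2 * P z) ^ k))" for k
      by (intro continuous_intros gc)
  qed
  also have "(\<lambda>k. T (\<lambda>z. ?g z * (inv_sqrt_coeff k * (v / 2 * P z) ^ k))) = (\<lambda>k. - T (\<lambda>z. outer_coeff k * (Q z ^ (k + 1) * s z ^ (2 * k + 1))))"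
  proof
    fix k
    have "T (\<lambda>z. ?g z * (inv_sqrt_coeff k * (v / 2 * P z) ^ k)) = T (\<lambda>z. (inv_sqrt_coeff k * (v / 2) ^ k) * (z * deriv P z * P z ^ k / s z))"
      by (rule T_cong) (simp add: power_mult_distrib power_divide mult_ac)
    also have "\<dots> = (inv_sqrt_coeff k * (v / 2) ^ k) * T (\<lambda>z. z * deriv P z * P z ^ k / s z)"
      using s_nz by (intro T_cmult continuous_intros) auto
    also have "\<dots> = - (outer_coeff k * T (\<lambda>z. Q z ^ (k + 1) * s z ^ (2 * k + 1)))"
      unfolding T_by_parts outer_coeff_def by simp
    also have "outer_coeff k * T (\<lambda>z. Q z ^ (k + 1) * s z ^ (2 * k + 1)) = T (\<lambda>z. outer_coeff k * (Q z ^ (k + 1) * s z ^ (2 * k + 1)))"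
      by (rule T_cmult[symmetric]) (intro continuous_intros)
    finally show "T (\<lambda>z. ?g z * (inv_sqrt_coeff k * (v / 2 * P z) ^ k)) = - T (\<lambda>z. outer_coeff k * (Q z ^ (k + 1) * s z ^ (2 * k + 1)))" .
  qed
  finally show ?thesis
    by (simp add: mult_ac)
qed

text \<open>The multi-index terms of Q^(k+1) (1 - r)^(k+1/2): every factor v_n z^n / Q lowers the
  exponent of Q by one, and \<open>idx_L N l - 1\<close> is the total power of z. Only the entries l
  n with n \<ge> 1 enter.\<close>

definition series_term :: "nat \<Rightarrow> (nat \<Rightarrow> nat) \<Rightarrow> complex \<Rightarrow> complex" where
  "series_term k l z = half_power_coeff k (idx_M N l) * (\<Prod>n=1..N-2. vs n ^ l n / fact (l n)) *
     (z ^ (idx_L N l - 1) * Q z powi (int k - int (idx_M N l) + 1))"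

lemma series_term_eq:
  assumes "z \<in> \<Gamma>"
  shows "series_term k l z = Q z ^ (k + 1) * (half_power_coeff k (sum l {1..N-2}) * (\<Prod>n=1..N-2. (vs n * z ^ n / Q z) ^ l n / fact (l n)))"
proof -
  have nz: "Q z \<noteq> 0" using Q_nz assms by blast
  have "(\<Prod>n=1..N-2. (vs n * z ^ n / Q z) ^ l n / fact (l n)) =
      (\<Prod>n=1..N-2. vs n ^ l n / fact (l n) * (z ^ (n * l n) / Q z ^ l n))"
    by (intro prod.cong) (auto simp: power_mult_distrib power_divide power_mult)
  also have "\<dots> = (\<Prod>n=1..N-2. vs n ^ l n / fact (l n)) * (z ^ (idx_L N l - 1) / Q z ^ idx_M N l)"
    unfolding prod.distrib prod_dividef by (simp add: idx_L_def idx_M_def flip: power_sum)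
  finally have "(\<Prod>n=1..N-2. (vs n * z ^ n / Q z) ^ l n / fact (l n)) =
      (\<Prod>n=1..N-2. vs n ^ l n / fact (l n)) * (z ^ (idx_L N l - 1) / Q z ^ idx_M N l)" .
  moreover have "Q z powi (int k - int (idx_M N l) + 1) = Q z ^ (k + 1) / Q z ^ idx_M N l"
    using nz by (simp add: power_int_add power_int_diff)
  ultimately show ?thesis
    by (simp add: series_term_def idx_M_def)
qed

text \<open>Uniform on the loop by |z| \<le> 2 and m \<le> |Q| \<le> 2^N + 2. It keeps the shape of
  a multinomial term in |v_n| 2^n / m, so that \<open>has_sum_multinomial\<close> evaluates its
  sum.\<close>

definition term_bound :: "nat \<Rightarrow> (nat \<Rightarrow> nat) \<Rightarrow> real" where
  "term_bound k l = 2 * (norm v / 2) ^ k * (2 ^ N + 2) ^ (k + 1) *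
    norm (half_power_coeff k (sum l {1..N-2}) * (\<Prod>n=1..N-2. complex_of_real (norm (vs n) * 2 ^ n / m) ^ l n / fact (l n)))"

lemma term_bound_nonneg: "0 \<le> term_bound k l"
  by (simp add: term_bound_def)

lemma norm_series_term_le:
  assumes "z \<in> \<Gamma>"
  shows "norm (outer_coeff k * series_term k l z) \<le> term_bound k l"
proof -
  have "(\<Prod>n=1..N-2. norm ((vs n * z ^ n / Q z) ^ l n / fact (l n) :: complex)) \<le>
      (\<Prod>n=1..N-2. norm (complex_of_real (norm (vs n) * 2 ^ n / m) ^ l n / fact (l n)))"
  proof (intro prod_mono conjI norm_ge_zero)
    fix n
    have "norm (vs n) * norm z ^ n / norm (Q z) \<le> norm (vs n) * 2 ^ n / m"
      using m(1) m(3)[OF assms] U_le[OF \<Gamma>_U[OF assms]] by (intro frac_le mult_left_mono power_mono) auto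
    then have "(norm (vs n) * norm z ^ n / norm (Q z)) ^ l n \<le> (norm (vs n) * 2 ^ n / m) ^ l n"
      by (intro power_mono) auto
    then show "norm ((vs n * z ^ n / Q z) ^ l n / fact (l n) :: complex) \<le>
       norm (complex_of_real (norm (vs n) * 2 ^ n / m) ^ l n / fact (l n))"
      using m(1) by (simp add: norm_mult norm_divide norm_power divide_right_mono)
  qed
  moreover have "norm (Q z) ^ (k + 1) \<le> (2 ^ N + 2) ^ (k + 1)"
    using norm_Q_le[OF \<Gamma>_U[OF assms]] by (intro power_mono) auto
  ultimately have "norm (outer_coeff k) * (norm (Q z) ^ (k + 1) * (norm (half_power_coeff k (sum l {1..N-2})) *
      (\<Prod>n=1..N-2. norm ((vs n * z ^ n / Q z) ^ l n / fact (l n) :: complex)))) \<le>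
    2 * (norm v / 2) ^ k * ((2 ^ N + 2) ^ (k + 1) * (norm (half_power_coeff k (sum l {1..N-2})) *
     (\<Prod>n=1..N-2. norm (complex_of_real (norm (vs n) * 2 ^ n / m) ^ l n / fact (l n)))))"
    using norm_outer_coeff_le[of k] by (intro mult_mono) (auto intro!: prod_nonneg mult_nonneg_nonneg)
  then show ?thesis
    unfolding series_term_eq[OF assms] term_bound_def norm_mult norm_power prod_norm[symmetric] by (simp only: mult.assoc)
qed

lemma half_power_coeff_geometric:
  assumes "(\<Sum>n=1..N-2. norm (y n :: complex)) \<le> 1/4"
  shows "summable (\<lambda>M. norm (half_power_coeff k M) / fact M * (\<Sum>n=1..N-2. norm (y n)) ^ M)"
    and "(\<Sum>M. norm (half_power_coeff k M) / fact M * (\<Sum>n=1..N-2. norm (y n)) ^ M) \<le> 2 ^ k * 2"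
proof -
  have le: "norm (half_power_coeff k M) / fact M * (\<Sum>n=1..N-2. norm (y n)) ^ M \<le> 2 ^ k * (1/4) ^ M" for M
    using assms norm_half_power_coeff_le[of k M] by (intro mult_mono power_mono) (auto intro: sum_nonneg zero_le_power[OF sum_nonneg])
  have sm: "summable (\<lambda>M. 2 ^ k * (1/4 :: real) ^ M)"
    by (intro summable_mult summable_geometric) auto
  show s: "summable (\<lambda>M. norm (half_power_coeff k M) / fact M * (\<Sum>n=1..N-2. norm (y n)) ^ M)"
    by (rule summable_comparison_test[OF _ sm]) (use le in \<open>auto simp: sum_nonneg\<close>)
  have "(\<Sum>M. norm (half_power_coeff k M) / fact M * (\<Sum>n=1..N-2. norm (y n)) ^ M) \<le> (\<Sum>M. 2 ^ k * (1/4 :: real) ^ M)"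
    by (rule suminf_le[OF le s sm])
  also have "\<dots> = 2 ^ k * (4/3)"
    by (subst suminf_mult) (auto simp: suminf_geometric)
  also have "\<dots> \<le> 2 ^ k * 2" by simp
  finally show "(\<Sum>M. norm (half_power_coeff k M) / fact M * (\<Sum>n=1..N-2. norm (y n)) ^ M) \<le> 2 ^ k * 2" .
qed

text \<open>The factor 2^k from the binomial coefficients cancels against (|v| / 2)^k, which leaves
  a constant times (|v| (2^N + 2))^k; by \<open>v_small\<close> this is geometric with ratio
  1/2.\<close>

lemma term_bound_has_sum:
  obtains b where "(term_bound k has_sum b) ({1..N-2} \<rightarrow>\<^sub>E UNIV)" "0 \<le> b" "b \<le> 4 * (2 ^ N + 2) * (1/2) ^ k"
proof -
  let ?y = "\<lambda>n. complex_of_real (norm (vs n) * 2 ^ n / m)"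
  let ?S = "(\<Sum>M. norm (half_power_coeff k M) / fact M * (\<Sum>n=1..N-2. norm (?y n)) ^ M)"
  have "(\<Sum>n=1..N-2. norm (?y n)) = (\<Sum>n=1..N-2. norm (vs n) * 2 ^ n) / m"
    using m(1) by (simp add: norm_mult norm_divide norm_power sum_divide_distrib)
  also have "\<dots> \<le> 1/4"
    using vs_small m(1) by (simp add: field_simps)
  finally have y: "(\<Sum>n=1..N-2. norm (?y n)) \<le> 1/4" .
  let ?b = "2 * (norm v / 2) ^ k * (2 ^ N + 2) ^ (k + 1) * ?S"
  have sums: "(term_bound k has_sum ?b) ({1..N-2} \<rightarrow>\<^sub>E UNIV)"
    unfolding term_bound_def
    by (intro has_sum_cmult_right has_sum_multinomial(1) half_power_coeff_geometric(1)[OF y]) simp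
  have "?S \<le> 2 ^ k * 2"
    by (rule half_power_coeff_geometric(2)[OF y])
  then have "?b \<le> 2 * (norm v / 2) ^ k * (2 ^ N + 2) ^ (k + 1) * (2 ^ k * 2)"
    by (intro mult_left_mono) auto
  also have "\<dots> = 4 * (2 ^ N + 2) * (norm v * (2 ^ N + 2)) ^ k"
    by (simp add: power_mult_distrib power_divide)
  also have "\<dots> \<le> 4 * (2 ^ N + 2) * (1/2) ^ k"
    using v_small by (intro mult_left_mono power_mono) auto
  finally have "?b \<le> 4 * (2 ^ N + 2) * (1/2) ^ k" .
  moreover have "0 \<le> ?b"
    by (rule has_sum_nonneg[OF sums]) (simp add: term_bound_nonneg)
  ultimately show thesis
    using sums that by blast
qed

lemma series_term_has_sum:
  assumes "z \<in> \<Gamma>"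
  shows "((\<lambda>l. outer_coeff k * series_term k l z) has_sum outer_coeff k * (Q z ^ (k + 1) * s z ^ (2 * k + 1))) ({1..N-2} \<rightarrow>\<^sub>E UNIV)"
proof -
  let ?y = "\<lambda>n. vs n * z ^ n / Q z"
  have "((\<lambda>l. half_power_coeff k (sum l {1..N-2}) * (\<Prod>n=1..N-2. ?y n ^ l n / fact (l n))) has_sum
      (\<Sum>M. half_power_coeff k M / fact M * (\<Sum>n=1..N-2. ?y n) ^ M)) ({1..N-2} \<rightarrow>\<^sub>E UNIV)"
    by (intro has_sum_multinomial(2) half_power_coeff_geometric(1) norm_r_terms_le[OF assms]) simp
  also have "(\<Sum>M. half_power_coeff k M / fact M * (\<Sum>n=1..N-2. ?y n) ^ M) = s z ^ (2 * k + 1)"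
  proof -
    have "(\<lambda>M. ((of_nat k + 1/2) gchoose M) * (-1) ^ M * r z ^ M) sums (s z ^ (2 * k + 1))"
      unfolding s_def using norm_r_le[OF assms] by (intro csqrt_odd_power_series) simp
    then show ?thesis
      by (simp add: half_power_coeff_def r_def sums_iff)
  qed
  finally have "((\<lambda>l. outer_coeff k * (Q z ^ (k + 1) * (half_power_coeff k (sum l {1..N-2}) * (\<Prod>n=1..N-2. ?y n ^ l n / fact (l n)))))
      has_sum outer_coeff k * (Q z ^ (k + 1) * s z ^ (2 * k + 1))) ({1..N-2} \<rightarrow>\<^sub>E UNIV)"
    by (intro has_sum_cmult_right)
  then show ?thesis
    by (simp only: series_term_eq[OF assms])
qed

lemma continuous_series_term [continuous_intros]: "continuous_on \<Gamma> (series_term k l)"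
  unfolding series_term_def by (intro continuous_intros)

lemma T_series_term: "T (\<lambda>z. outer_coeff k * series_term k l z) = outer_coeff k * (half_power_coeff k (idx_M N l) * (\<Prod>n=1..N-2. vs n ^ l n / fact (l n)) *
    \<tau> (idx_L N l) (int k - int (idx_M N l)))"
proof -
  have "T (\<lambda>z. outer_coeff k * series_term k l z) = outer_coeff k * T (series_term k l)"
    by (intro T_cmult continuous_intros)
  also have "T (series_term k l) = half_power_coeff k (idx_M N l) * (\<Prod>n=1..N-2. vs n ^ l n / fact (l n)) *
    \<tau> (idx_L N l) (int k - int (idx_M N l))"
    unfolding series_term_def \<tau>_def by (intro T_cmult continuous_intros)
  finally show ?thesis .
qed

text \<open>Summing first over l and then over k would not by itself give an unordered sum.
  \<open>term_bound\<close> dominates all pairs at once, so \<open>T\<close> passes through the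
  double sum. Its value is found afterwards by summing over l first and comparing with
  \<open>T_inverse_csqrt_series\<close>.\<close>

lemma T_double_series:
  "((\<lambda>(k, l). - T (\<lambda>z. outer_coeff k * series_term k l z)) has_sum T (\<lambda>z. z * deriv P z / csqrt (1 - v / 2 * P z) / s z))
     (UNIV \<times> ({1..N-2} \<rightarrow>\<^sub>E UNIV))"
proof -
  let ?I = "UNIV \<times> ({1..N-2} \<rightarrow>\<^sub>E (UNIV :: nat set))"
  have "\<forall>k. \<exists>b. (term_bound k has_sum b) ({1..N-2} \<rightarrow>\<^sub>E UNIV) \<and> 0 \<le> b \<and> b \<le> 4 * (2 ^ N + 2) * (1/2) ^ k"
    using term_bound_has_sum by blast
  then obtain b where b: "\<And>k. (term_bound k has_sum b k) ({1..N-2} \<rightarrow>\<^sub>E UNIV)" "\<And>k. 0 \<le> b k" "\<And>k. b k \<le> 4 * (2 ^ N + 2) * (1/2) ^ k"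
    by metis
  have "(\<lambda>k. 4 * (2 ^ N + 2) * (1/2 :: real) ^ k) summable_on UNIV"
    by (intro summable_on_cmult_right) (auto intro!: norm_summable_imp_summable_on summable_geometric)
  then have "b summable_on UNIV"
    by (rule summable_on_comparison_test) (use b in auto)
  then have Bs: "(\<lambda>(k, l). term_bound k l) summable_on ?I"
    using b(1) by (intro summable_on_SigmaI[where g = b]) (auto simp: term_bound_nonneg)
  \<comment> \<open>The pointwise value may stay unevaluated: convergence suffices, since only the
    image under \<open>T\<close> is identified.\<close>
  have ptw: "((\<lambda>i. case i of (k, l) \<Rightarrow> outer_coeff k * series_term k l z) has_sum (\<Sum>\<^sub>\<infinity>(k, l)\<in>?I. outer_coeff k * series_term k l z)) ?I"
    if "z \<in> \<Gamma>" for z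
    using norm_series_term_le[OF that]
    by (intro has_sum_infsum abs_summable_summable[OF Infinite_Sum.abs_summable_on_comparison_test'[OF Bs]]) auto
  have "((\<lambda>i. T (case i of (k, l) \<Rightarrow> \<lambda>z. outer_coeff k * series_term k l z)) has_sum T (\<lambda>z. \<Sum>\<^sub>\<infinity>(k, l)\<in>?I. outer_coeff k * series_term k l z)) ?I"
    by (rule T_has_sum[OF _ Bs]) (use norm_series_term_le ptw in \<open>auto simp: case_prod_unfold intro!: continuous_intros\<close>)
  then have dbl: "((\<lambda>(k, l). T (\<lambda>z. outer_coeff k * series_term k l z)) has_sum T (\<lambda>z. \<Sum>\<^sub>\<infinity>(k, l)\<in>?I. outer_coeff k * series_term k l z)) ?I"
    by (simp add: case_prod_unfold)
  have inner: "((\<lambda>l. T (\<lambda>z. outer_coeff k * series_term k l z)) has_sum T (\<lambda>z. outer_coeff k * (Q z ^ (k + 1) * s z ^ (2 * k + 1)))) ({1..N-2} \<rightarrow>\<^sub>E UNIV)" for k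
    using b(1)[of k] by (intro T_has_sum[where B = "term_bound k"] series_term_has_sum norm_series_term_le continuous_intros) (auto simp: summable_on_def)
  have "((\<lambda>k. T (\<lambda>z. outer_coeff k * (Q z ^ (k + 1) * s z ^ (2 * k + 1)))) has_sum T (\<lambda>z. \<Sum>\<^sub>\<infinity>(k, l)\<in>?I. outer_coeff k * series_term k l z)) UNIV"
    by (rule has_sum_Sigma'[OF dbl]) (use inner in auto)
  moreover have "((\<lambda>k. T (\<lambda>z. outer_coeff k * (Q z ^ (k + 1) * s z ^ (2 * k + 1)))) has_sum
     - T (\<lambda>z. z * deriv P z / csqrt (1 - v / 2 * P z) / s z)) UNIV"
    using has_sum_uminusI[OF T_inverse_csqrt_series] by simp
  ultimately have "T (\<lambda>z. \<Sum>\<^sub>\<infinity>(k, l)\<in>?I. outer_coeff k * series_term k l z) = - T (\<lambda>z. z * deriv P z / csqrt (1 - v / 2 * P z) / s z)"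
    by (rule has_sum_unique)
  then show ?thesis
    using has_sum_uminusI[OF dbl] by (simp add: case_prod_unfold)
qed

section \<open>Identification with the Gamma factors of \<open>R_term\<close>\<close>

lemma Gamma_half_nat: "real k + 1/2 \<notin> \<int>\<^sub>\<le>\<^sub>0"
  by (auto elim!: nonpos_Ints_cases)

text \<open>The falling factorial in \<open>half_power_coeff\<close> turns Gamma(k-M+3/2) from
  \<open>\<tau>_Gamma\<close> into Gamma(k+3/2), and the divisor k + 1/2 of
  \<open>outer_coeff\<close> turns that into Gamma(k+1/2). A second Gamma(k+1/2) comes from the
  coefficient of (1 - x)^(-1/2).\<close>

lemma double_series_term:
  fixes l :: "nat \<Rightarrow> nat"
  defines "k \<equiv> l 0"
  shows "- T (\<lambda>z. outer_coeff k * series_term k l z) = - of_real (sqrt pi) / of_nat N * R_term N \<zeta> v vs l"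
proof -
  define M where "M = idx_M N l"
  define L where "L = idx_L N l"
  have "L \<ge> 1" by (simp add: L_def idx_L_def)
  have half: "(real k + 1/2) * Gamma (real k + 1/2) = Gamma (real k + 3/2)"
    using Gamma_plus1[OF Gamma_half_nat[of k]] by (simp add: add.assoc)
  have "pochhammer (1/2 :: real) k = Gamma (1/2 + real k) / Gamma (1/2)"
    by (rule pochhammer_Gamma) (use Gamma_half_nat[of 0] in simp)
  then have "(- (1/2) :: real) gchoose k = (-1) ^ k * (Gamma (real k + 1/2) / (sqrt pi * fact k))"
    by (simp add: gbinomial_pochhammer Gamma_one_half_real add.commute)
  then have "complex_of_real ((- (1/2)) gchoose k) * (-1) ^ k = of_real (Gamma (real k + 1/2) / (sqrt pi * fact k))"
    by (simp flip: power_add mult_2)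
  then have inv_sqrt_coeff: "inv_sqrt_coeff k = of_real (Gamma (real k + 1/2) / (sqrt pi * fact k))"
    by (simp add: inv_sqrt_coeff_def gbinomial_prod_rev)
  \<comment> \<open>For M > k the argument may be negative, but as a half-integer it is never a
    pole.\<close>
  have Gnz: "Gamma (real_of_int (int k - int M) + 3/2) \<noteq> 0"
  proof -
    have "real_of_int (int k - int M) + 3/2 \<notin> \<int>\<^sub>\<le>\<^sub>0"
    proof
      assume "real_of_int (int k - int M) + 3/2 \<in> \<int>\<^sub>\<le>\<^sub>0"
      then obtain i where "real_of_int (int k - int M) + 3/2 = real_of_int i"
        by (auto elim!: nonpos_Ints_cases)
      then have "real_of_int (2 * (int k - int M) + 3) = real_of_int (2 * i)" by simp
      then have "2 * (int k - int M) + 3 = 2 * i" by (subst (asm) of_int_eq_iff)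
      then show False by presburger
    qed
    then show ?thesis by (simp add: Gamma_eq_zero_iff)
  qed
  then have ni: "real_of_int (int k - int M) + 3/2 \<notin> \<int>\<^sub>\<le>\<^sub>0"
    by (simp add: Gamma_eq_zero_iff)
  have G: "(real k + 1/2 gchoose M) * fact M * Gamma (real_of_int (int k - int M) + 3/2) = Gamma (real k + 3/2)"
  proof -
    have "pochhammer (real_of_int (int k - int M) + 3/2) M =
        Gamma (real_of_int (int k - int M) + 3/2 + real M) / Gamma (real_of_int (int k - int M) + 3/2)"
      using ni by (rule pochhammer_Gamma)
    moreover have "(real k + 1/2 gchoose M) * fact M = pochhammer (real k + 1/2 - real M + 1) M"
      by (simp add: gbinomial_pochhammer')
    moreover have "real k + 1/2 - real M + 1 = real_of_int (int k - int M) + 3/2" by simp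
    moreover have "real_of_int (int k - int M) + 3/2 + real M = real k + 3/2" by simp
    ultimately show ?thesis
      using Gnz by simp
  qed
  have "half_power_coeff k M = of_real ((-1) ^ M * ((real k + 1/2 gchoose M) * fact M))"
    by (simp add: half_power_coeff_def gbinomial_prod_rev)
  then have "half_power_coeff k M * of_real (Gamma (real_of_int (int k - int M) + 3/2)) = of_real ((-1) ^ M * Gamma (real k + 3/2))"
    unfolding G[symmetric] by (simp only: of_real_mult mult.assoc)
  then have half_power_coeff: "half_power_coeff k M * of_real (Gamma (real_of_int (int k - int M) + 3/2)) = (-1) ^ M * of_real (Gamma (real k + 3/2))"
    by simp
  define c where "c = real L / real N"
  \<comment> \<open>By definition 2 \<alpha> = M - L/N.\<close>
  have alpha: "3/2 - 2 * idx_alpha N l + real k = c + real_of_int (int k - int M) + 3/2"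
    using N by (simp add: idx_alpha_def c_def k_def L_def M_def field_simps)
  have dc: "outer_coeff k * (of_real (Gamma (real k + 3/2))) = of_real ((Gamma (real k + 1/2))\<^sup>2 / (sqrt pi * fact k)) * (v / 2) ^ k"
  proof -
    have "complex_of_real (real k + 1/2) \<noteq> 0" 
      unfolding of_real_eq_0_iff by (simp add: add_nonneg_eq_0_iff)
    then show ?thesis
      unfolding outer_coeff_def inv_sqrt_coeff half[symmetric] by (simp add: power2_eq_square)
  qed
  define V where "V = (\<Prod>n=1..N-2. vs n ^ l n)"
  define F where "F = (\<Prod>n=1..N-2. fact (l n) :: complex)"
  have fp: "(\<Prod>n=0..N-2. fact (l n) :: complex) = fact k * F"
    by (simp add: F_def k_def prod.atLeast_Suc_atMost)
  have "F \<noteq> 0" by (simp add: F_def)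
  have "- T (\<lambda>z. outer_coeff k * series_term k l z) = - (outer_coeff k * (half_power_coeff k M * (V / F) * \<tau> L (int k - int M)))"
    unfolding T_series_term by (simp add: M_def L_def V_def F_def prod_dividef)
  also have "\<dots> = outer_coeff k * (half_power_coeff k M * of_real (Gamma (real_of_int (int k - int M) + 3/2))) * (V / F) * (\<zeta> ^ L / of_nat N)
       * of_real (Gamma c * rGamma (c + real_of_int (int k - int M) + 3/2))"
    unfolding \<tau>_Gamma[OF \<open>L \<ge> 1\<close>] c_def[symmetric] by simp
  also have "\<dots> = outer_coeff k * of_real (Gamma (real k + 3/2)) * (-1) ^ M * (V / F) * (\<zeta> ^ L / of_nat N)
       * of_real (Gamma c * rGamma (c + real_of_int (int k - int M) + 3/2))"
    unfolding half_power_coeff by simp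
  also have "\<dots> = of_real ((Gamma (real k + 1/2))\<^sup>2 / (sqrt pi * fact k)) * (v / 2) ^ k * (-1) ^ M * (V / F) * (\<zeta> ^ L / of_nat N)
       * of_real (Gamma c * rGamma (c + real_of_int (int k - int M) + 3/2))"
    unfolding dc by simp
  also have "\<dots> = - of_real (sqrt pi) / of_nat N * R_term N \<zeta> v vs l"
  proof -
    have "complex_of_real (sqrt pi) * complex_of_real (sqrt pi) = of_real pi"
      by (simp flip: of_real_mult)
    then have sp: "complex_of_real (sqrt pi) * (complex_of_real (sqrt pi) * x) = of_real pi * x" for x
      by (simp flip: mult.assoc)
    define W where "W = rGamma (c + real_of_int (int k - int M) + 3/2)"
    have "R_term N \<zeta> v vs l = (-1) ^ (M + 1) * \<zeta> ^ L * of_real (Gamma c * (Gamma (real k + 1/2))\<^sup>2 / (sqrt pi)\<^sup>2 * W)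
        * (v ^ k * V) / (2 ^ k * (fact k * F))"
      unfolding R_term_def k_def[symmetric] M_def[symmetric] L_def[symmetric] fp V_def[symmetric] c_def[symmetric] alpha W_def
        Gamma_one_half_real ..
    then show ?thesis
      unfolding W_def[symmetric] using \<open>F \<noteq> 0\<close> N by (simp add: field_simps power2_eq_square sp)
  qed
  finally show ?thesis .
qed

text \<open>A pair (k, l) is the multi-index with k stored in the entry 0; this reindexing is a
  bijection, and \<open>series_term\<close> does not see that entry.\<close>

lemma R_term_has_sum:
  assumes E: "E holomorphic_on U"
    "\<And>z. z \<in> U \<Longrightarrow> P z * deriv E z + deriv P z * E z / 2 = z * deriv P z / csqrt (1 - v / 2 * P z)"
  shows "(R_term N \<zeta> v vs has_sum - (of_nat N / of_real (sqrt pi)) * E 0) ({0..N-2} \<rightarrow>\<^sub>E UNIV)"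
proof -
  let ?h = "\<lambda>(k, l). l(0 := k)" and ?J = "{1..N-2} \<rightarrow>\<^sub>E (UNIV :: nat set)"
  have ins: "{0..N-2} = insert 0 {1..N-2}" by auto
  have img: "{0..N-2} \<rightarrow>\<^sub>E UNIV = ?h ` (UNIV \<times> ?J)"
    unfolding ins PiE_insert_eq by simp
  have inj: "inj_on ?h (UNIV \<times> ?J)"
    by (rule inj_combinator) simp
  have term_eq: "- T (\<lambda>z. outer_coeff k * series_term k l z) = - of_real (sqrt pi) / of_nat N * R_term N \<zeta> v vs (l(0 := k))" for k l
  proof -
    have "series_term k (l(0 := k)) = series_term k l"
      unfolding series_term_def idx_M_def idx_L_def by (intro ext arg_cong2[where f = "(*)"] arg_cong2[where f = half_power_coeff] arg_cong2[where f = power]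
        arg_cong2[where f = "power_int"] arg_cong2[where f = minus] arg_cong2[where f = plus] refl prod.cong sum.cong arg_cong[where f = int]) auto
    then show ?thesis
      using double_series_term[of "l(0 := k)"] by simp
  qed
  have "((\<lambda>(k, l). - of_real (sqrt pi) / of_nat N * R_term N \<zeta> v vs (l(0 := k))) has_sum E 0) (UNIV \<times> ?J)"
    using T_double_series T_ode_solution[OF E] by (simp only: term_eq)
  then have "((\<lambda>l. - of_real (sqrt pi) / of_nat N * R_term N \<zeta> v vs l) has_sum E 0) ({0..N-2} \<rightarrow>\<^sub>E UNIV)"
    unfolding img has_sum_reindex[OF inj] by (simp add: o_def case_prod_unfold)
  from has_sum_cmult_right[OF this, of "- (of_nat N / of_real (sqrt pi))"] show ?thesis
    using N by simp
qed

end

subsection \<open>The branch point of the perturbed curve\<close>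

lemma compact_norm_lower_bound:
  fixes f :: "'a::topological_space \<Rightarrow> 'b::real_normed_vector"
  assumes "compact K" "continuous_on K f" "\<And>z. z \<in> K \<Longrightarrow> f z \<noteq> 0"
  obtains m where "0 < m" "\<And>z. z \<in> K \<Longrightarrow> m \<le> norm (f z)"
proof (cases "K = {}")
  case False
  then obtain x where "x \<in> K" "\<And>z. z \<in> K \<Longrightarrow> norm (f x) \<le> norm (f z)"
    using continuous_attains_inf[OF assms(1) _ continuous_on_norm[OF assms(2)]] by blast
  then show thesis
    using assms(3) by (intro that[of "norm (f x)"]) auto
qed (use that[of 1] in auto)

text \<open>The quotient of the two roots is continuous with values in {1, -1}, hence constant. It
  identifies a continued root with a principal one.\<close>

lemma continuous_sqrt_unique:
  fixes g h :: "real \<Rightarrow> complex"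
  assumes "continuous_on {0..1} g" "continuous_on {0..1} h"
    and "\<And>t. t \<in> {0..1} \<Longrightarrow> (g t)\<^sup>2 = (h t)\<^sup>2" "\<And>t. t \<in> {0..1} \<Longrightarrow> h t \<noteq> 0" "g 0 = h 0" "t \<in> {0..1}"
  shows "g t = h t"
proof -
  let ?r = "\<lambda>t. g t / h t"
  have "(?r x)\<^sup>2 = 1" if "x \<in> {0..1}" for x
    using assms(3,4)[OF that] by (simp add: power_divide)
  then have "?r ` {0..1} \<subseteq> {1, -1}"
    using power2_eq_1_iff by blast
  then have "finite (?r ` {0..1})"
    by (rule finite_subset) simp
  moreover have "continuous_on {0..1} ?r"
    using assms by (intro continuous_intros) auto
  ultimately have "?r constant_on {0..1}"
    by (intro continuous_finite_range_constant) auto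
  then have "?r t = ?r 0"
    using assms(6) unfolding constant_on_def by (metis atLeastAtMost_iff order_refl zero_le_one)
  then show ?thesis
    using assms(4)[of t] assms(4)[of 0] assms(5,6) by simp
qed

lemma norm_root_of_minus_one:
  fixes \<zeta> :: complex
  assumes "\<zeta> ^ N = -1" "N > 0"
  shows "norm \<zeta> = 1"
proof -
  have "norm \<zeta> ^ N = 1 ^ N"
    using assms by (simp flip: norm_power)
  then show ?thesis
    by (rule power_eq_imp_eq_base) (use assms(2) in auto)
qed

section \<open>The neighbourhood of the segment that contains all admissible paths\<close>

definition tube :: "complex \<Rightarrow> real \<Rightarrow> complex set" where
  "tube \<zeta> \<rho> = (\<Union>x\<in>closed_segment 0 \<zeta>. ball x \<rho>)"

text \<open>The closed version is compact, so that Q is bounded below on it away from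
  \<zeta>.\<close>

definition ctube :: "complex \<Rightarrow> real \<Rightarrow> complex set" where
  "ctube \<zeta> \<rho> = (\<Union>x\<in>closed_segment 0 \<zeta>. cball x \<rho>)"

lemma tube_subset_ctube: "tube \<zeta> \<rho> \<subseteq> ctube \<zeta> \<rho>"
  by (force simp: tube_def ctube_def)

lemma open_tube: "open (tube \<zeta> \<rho>)"
  by (auto simp: tube_def)

text \<open>The tube is the Minkowski sum of a segment and a ball.\<close>

lemma convex_tube: "convex (tube \<zeta> \<rho>)"
proof -
  have "tube \<zeta> \<rho> = (\<Union>x\<in>closed_segment 0 \<zeta>. \<Union>y\<in>ball 0 \<rho>. {x + y})"
  proof (intro equalityI subsetI)
    fix z assume "z \<in> tube \<zeta> \<rho>"
    then obtain x where "x \<in> closed_segment 0 \<zeta>" "z - x \<in> ball 0 \<rho>"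
      by (auto simp: tube_def dist_norm norm_minus_commute)
    then show "z \<in> (\<Union>x\<in>closed_segment 0 \<zeta>. \<Union>y\<in>ball 0 \<rho>. {x + y})"
      by (intro UN_I[of x] UN_I[of "z - x"]) auto
  next
    fix z assume "z \<in> (\<Union>x\<in>closed_segment 0 \<zeta>. \<Union>y\<in>ball 0 \<rho>. {x + y})"
    then obtain x y where "x \<in> closed_segment 0 \<zeta>" "norm y < \<rho>" "z = x + y" by auto
    then show "z \<in> tube \<zeta> \<rho>"
      unfolding tube_def by (intro UN_I[of x]) (auto simp: dist_norm)
  qed
  then show ?thesis
    using convex_sums[OF convex_closed_segment convex_ball] by simp
qed

lemma compact_ctube: "compact (ctube \<zeta> \<rho>)"
proof -
  have "ctube \<zeta> \<rho> = {x + y | x y. x \<in> closed_segment 0 \<zeta> \<and> y \<in> cball 0 \<rho>}"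
  proof (intro equalityI subsetI)
    fix z assume "z \<in> ctube \<zeta> \<rho>"
    then obtain x where "x \<in> closed_segment 0 \<zeta>" "z - x \<in> cball 0 \<rho>"
      by (auto simp: ctube_def dist_norm norm_minus_commute)
    then show "z \<in> {x + y | x y. x \<in> closed_segment 0 \<zeta> \<and> y \<in> cball 0 \<rho>}"
      by (intro CollectI exI[of _ x] exI[of _ "z - x"]) auto
  next
    fix z assume "z \<in> {x + y | x y. x \<in> closed_segment 0 \<zeta> \<and> y \<in> cball 0 \<rho>}"
    then obtain x y where "x \<in> closed_segment 0 \<zeta>" "norm y \<le> \<rho>" "z = x + y" by auto
    then show "z \<in> ctube \<zeta> \<rho>"
      unfolding ctube_def by (intro UN_I[of x]) (auto simp: dist_norm)
  qed
  then show ?thesis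
    by (simp only: compact_sums[OF compact_segment compact_cball])
qed

lemma norm_ctube_le:
  assumes "z \<in> ctube \<zeta> \<rho>" "norm \<zeta> = 1"
  shows "norm z \<le> 1 + \<rho>"
proof -
  obtain x where x: "x \<in> closed_segment 0 \<zeta>" "dist x z \<le> \<rho>"
    using assms by (auto simp: ctube_def)
  have "norm x \<le> 1"
    using x(1) assms(2) by (auto simp: closed_segment_def)
  then show ?thesis
    using x(2) norm_triangle_sub[of z x] by (simp add: dist_norm norm_minus_commute)
qed

lemma linepath_nearby_tube:
  "dist x (linepath 0 \<zeta> t) < \<rho> \<Longrightarrow> t \<in> {0..1} \<Longrightarrow> x \<in> tube \<zeta> \<rho>"
  unfolding tube_def using linepath_in_path[of t 0 \<zeta>] by (intro UN_I[of "linepath 0 \<zeta> t"]) (auto simp: dist_commute)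

text \<open>Two demands fix \<rho>: on the closed ball the derivative of z^N differs from its value
  at \<zeta> by a relative error of at most 1/4, as the later contraction needs, and the closed tube
  contains no root of -1 other than \<zeta>. The other roots form a finite set at positive distance
  from the segment.\<close>

lemma tube_radius:
  fixes \<zeta> :: complex
  assumes N: "N \<ge> 1" and \<zeta>: "\<zeta> ^ N = -1"
  obtains \<rho> where "0 < \<rho>" "\<rho> \<le> 1" "\<And>z. z \<in> cball \<zeta> \<rho> \<Longrightarrow> norm (1 - (z / \<zeta>) ^ (N - 1)) \<le> 1/4"
    "\<And>z. z \<in> ctube \<zeta> \<rho> \<Longrightarrow> 1 + z ^ N = 0 \<Longrightarrow> z = \<zeta>"
proof -
  have nz: "\<zeta> \<noteq> 0" using \<zeta> N by (auto simp: power_0_left)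
  have "((\<lambda>z. norm (1 - (z / \<zeta>) ^ (N - 1))) \<longlongrightarrow> norm (1 - (\<zeta> / \<zeta>) ^ (N - 1))) (at \<zeta>)"
    using nz by (intro tendsto_intros)
  then have "\<forall>\<^sub>F z in at \<zeta>. norm (1 - (z / \<zeta>) ^ (N - 1)) < 1/4"
    using nz by (intro order_tendstoD(2)) auto
  then obtain d1 where d1: "d1 > 0" "\<And>z. z \<noteq> \<zeta> \<Longrightarrow> dist z \<zeta> < d1 \<Longrightarrow> norm (1 - (z / \<zeta>) ^ (N - 1)) < 1/4"
    unfolding eventually_at by auto
  define Z where "Z = {z :: complex. 1 + z ^ N = 0} - {\<zeta>}"
  have "finite {z :: complex. z ^ N = -1}"
    using N by (intro finite_nth_roots) auto
  then have "finite Z"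
    by (rule finite_subset[rotated]) (auto simp: Z_def add_eq_0_iff minus_equation_iff)
  \<comment> \<open>The N-th power of t \<zeta> is -t^N, which equals -1 on the segment only for t =
    1.\<close>
  moreover have "closed_segment 0 \<zeta> \<inter> Z = {}"
  proof -
    have False if "t \<in> {0..1}" "t *\<^sub>R \<zeta> \<in> Z" for t
    proof -
      have "1 + of_real t ^ N * (-1 :: complex) = 0" "t *\<^sub>R \<zeta> \<noteq> \<zeta>"
        using that(2) by (auto simp: Z_def scaleR_conv_of_real power_mult_distrib \<zeta>)
      then have "complex_of_real (t ^ N) = of_real (1 ^ N)" "t \<noteq> 1" by auto
      then have "t ^ N = 1 ^ N" "t \<noteq> 1" unfolding of_real_eq_iff by auto
      then show False
        using that(1) N power_eq_imp_eq_base[of t N 1] by auto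
    qed
    then show ?thesis by (auto simp: closed_segment_def)
  qed
  ultimately obtain d2 where d2: "d2 > 0" "\<And>x y. x \<in> closed_segment 0 \<zeta> \<Longrightarrow> y \<in> Z \<Longrightarrow> d2 \<le> dist x y"
    using separate_compact_closed[of "closed_segment 0 \<zeta>" Z] by (metis compact_segment finite_imp_closed)
  define \<rho> where "\<rho> = min 1 (min (d1 / 2) (d2 / 2))"
  have \<rho>: "0 < \<rho>" "\<rho> \<le> 1" "\<rho> < d1" "\<rho> < d2"
    using d1(1) d2(1) by (auto simp: \<rho>_def)
  show thesis
  proof
    show "norm (1 - (z / \<zeta>) ^ (N - 1)) \<le> 1/4" if "z \<in> cball \<zeta> \<rho>" for z
    proof (cases "z = \<zeta>")
      case False
      have "dist z \<zeta> < d1" using that \<rho>(3) by (simp add: dist_commute)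
      from d1(2)[OF False this] show ?thesis by simp
    qed (use nz in auto)
    show "z = \<zeta>" if z: "z \<in> ctube \<zeta> \<rho>" "1 + z ^ N = 0" for z
    proof (rule ccontr)
      assume "z \<noteq> \<zeta>"
      then have "z \<in> Z" using z by (simp add: Z_def)
      moreover obtain x where "x \<in> closed_segment 0 \<zeta>" "dist x z \<le> \<rho>"
        using z by (auto simp: ctube_def)
      ultimately show False using d2(2)[of x z] \<rho> by simp
    qed
  qed (use \<rho> in auto)
qed

text \<open>With \<delta> = \<rho>/4 the point 1 - s^2 differs from a point of [0, 1] by at most
  \<delta>^2 + 2 \<delta> \<le> 3 \<delta> < \<rho>, and multiplication by \<zeta> is an
  isometry.\<close>

lemma half_loop_in_tube:
  assumes \<rho>: "0 < \<rho>" "\<rho> \<le> 1" and \<zeta>: "norm \<zeta> = 1"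
    and s: "s \<in> path_image (linepath 1 (\<i> * of_real (\<rho> / 4)) +++ linepath (\<i> * of_real (\<rho> / 4)) (-1))"
  shows "\<zeta> * (1 - s\<^sup>2) \<in> tube \<zeta> \<rho>"
proof -
  define \<delta> where "\<delta> = \<rho> / 4"
  have \<delta>: "0 < \<delta>" "\<delta> \<le> 1" "3 * \<delta> < \<rho>" using \<rho> by (auto simp: \<delta>_def)
  have small: "norm (of_real (\<delta>\<^sup>2 * a\<^sup>2) + \<i> * of_real (2 * \<delta> * b)) < \<rho>"
    if "0 \<le> a" "a \<le> 1" "\<bar>b\<bar> \<le> 1" for a b
  proof -
    have "norm (of_real (\<delta>\<^sup>2 * a\<^sup>2) + \<i> * of_real (2 * \<delta> * b)) \<le> \<delta>\<^sup>2 * a\<^sup>2 + 2 * \<delta> * \<bar>b\<bar>"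
      using \<delta> by (intro order_trans[OF norm_triangle_ineq]) (auto simp: norm_mult abs_mult simp del: of_real_mult of_real_power)
    also have "\<delta>\<^sup>2 * a\<^sup>2 \<le> \<delta> * 1"
      using \<delta> that unfolding power2_eq_square by (intro mult_mono) (auto intro: mult_le_one mult_left_le)
    also have "2 * \<delta> * \<bar>b\<bar> \<le> 2 * \<delta>"
      using \<delta> that by simp
    finally show ?thesis using \<delta> by simp
  qed
  have ball: "\<zeta> * (of_real x + e) \<in> tube \<zeta> \<rho>" if "0 \<le> x" "x \<le> 1" "norm e < \<rho>" for x e
  proof (rule linepath_nearby_tube)
    have "\<zeta> * (of_real x + e) - linepath 0 \<zeta> x = \<zeta> * e"
      by (simp add: linepath_def scaleR_conv_of_real algebra_simps)
    then show "dist (\<zeta> * (of_real x + e)) (linepath 0 \<zeta> x) < \<rho>"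
      using that \<zeta> by (simp add: dist_norm norm_mult)
  qed (use that in auto)
  obtain u where u: "0 \<le> u" "u \<le> 1" "s = (1 - u) *\<^sub>R 1 + u *\<^sub>R (\<i> * of_real \<delta>) \<or> s = (1 - u) *\<^sub>R (\<i> * of_real \<delta>) + u *\<^sub>R (-1)"
    using s by (auto simp: path_image_join in_segment \<delta>_def)
  have uu: "\<bar>u * (1 - u)\<bar> \<le> 1"
    using u by (simp add: abs_mult mult_le_one)
  from u(3) show ?thesis
  proof
    assume s: "s = (1 - u) *\<^sub>R 1 + u *\<^sub>R (\<i> * of_real \<delta>)"
    have "1 - s\<^sup>2 = of_real (1 - (1 - u)\<^sup>2) + (of_real (\<delta>\<^sup>2 * u\<^sup>2) + \<i> * of_real (2 * \<delta> * - (u * (1 - u))))"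
      unfolding s by (simp add: complex_eq_iff power2_eq_square algebra_simps)
    then show ?thesis
      using u uu by (simp only:) (intro ball small; auto simp: power_le_one)
  next
    assume s: "s = (1 - u) *\<^sub>R (\<i> * of_real \<delta>) + u *\<^sub>R (-1)"
    have "1 - s\<^sup>2 = of_real (1 - u\<^sup>2) + (of_real (\<delta>\<^sup>2 * (1 - u)\<^sup>2) + \<i> * of_real (2 * \<delta> * (u * (1 - u))))"
      unfolding s by (simp add: complex_eq_iff power2_eq_square algebra_simps)
    then show ?thesis
      using u uu by (simp only:) (intro ball small; auto simp: power_le_one)
  qed
qed

lemma half_loop_tube:
  assumes N: "N \<ge> 3" and \<zeta>: "\<zeta> ^ N = -1" and \<rho>: "0 < \<rho>" "\<rho> \<le> 1"
    and Z: "\<And>z. z \<in> ctube \<zeta> \<rho> \<Longrightarrow> 1 + z ^ N = 0 \<Longrightarrow> z = \<zeta>"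
  obtains H where "half_loop N \<zeta> (tube \<zeta> \<rho>) H (\<rho> / 4)"
proof -
  let ?U = "tube \<zeta> \<rho>" and ?Q = "\<lambda>z :: complex. 1 + z ^ N"
  have n1: "norm \<zeta> = 1" using norm_root_of_minus_one[OF \<zeta>] N by simp
  have nz: "\<zeta> \<noteq> 0" using n1 by auto
  have mem: "0 \<in> ?U" "\<zeta> \<in> ?U"
    using \<rho> UN_I[of 0 "closed_segment 0 \<zeta>" 0 "\<lambda>x. ball x \<rho>"] UN_I[of \<zeta> "closed_segment 0 \<zeta>" \<zeta> "\<lambda>x. ball x \<rho>"]
    by (auto simp: tube_def)
  have Z': "z = \<zeta>" if "z \<in> ?U" "?Q z = 0" for z
    using Z that tube_subset_ctube by blast
  have "(?Q has_field_derivative of_nat N * \<zeta> ^ (N - 1)) (at \<zeta>)"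
    by (auto intro!: derivative_eq_intros)
  then have "deriv ?Q \<zeta> = of_nat N * \<zeta> ^ (N - 1)"
    by (rule DERIV_imp_deriv)
  then have dQ: "deriv ?Q \<zeta> \<noteq> 0"
    using nz N by simp
  obtain G where G: "G holomorphic_on ?U" "\<And>z. z \<in> ?U \<Longrightarrow> G z \<noteq> 0" "\<And>z. z \<in> ?U \<Longrightarrow> ?Q z = (z - \<zeta>) * (G z)\<^sup>2"
  proof (rule simple_zero_sqrt_factor[of ?U ?Q \<zeta>])
    show "?Q holomorphic_on ?U" by (intro holomorphic_intros)
  qed (use open_tube convex_tube mem dQ \<zeta> Z' in auto)
  \<comment> \<open>Dividing G by G 0 therefore both normalises H at 0 and turns the factor z -
    \<zeta> into 1 - z / \<zeta>.\<close>
  have G0: "1 = - \<zeta> * (G 0)\<^sup>2"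
    using G(3)[OF mem(1)] N by (simp add: power_0_left)
  show thesis
  proof (rule that[of "\<lambda>z. G z / G 0"], unfold_locales)
    show "(\<lambda>z. G z / G 0) holomorphic_on ?U"
      using G mem by (intro holomorphic_intros) auto
    show "?Q z = (1 - z / \<zeta>) * (G z / G 0)\<^sup>2" if "z \<in> ?U" for z
    proof -
      have "(1 - z / \<zeta>) * (G z / G 0)\<^sup>2 = (1 - z / \<zeta>) * ((G z)\<^sup>2 / (G 0)\<^sup>2)"
        by (simp add: power_divide)
      also have "\<dots> = (1 - z / \<zeta>) * (G z)\<^sup>2 * (- \<zeta>)"
        using inverse_unique[of "(G 0)\<^sup>2" "- \<zeta>"] G0 by (simp add: divide_inverse mult.commute)
      also have "\<dots> = (z - \<zeta>) * (G z)\<^sup>2"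
        using nz by (simp add: field_simps)
      finally show ?thesis using G(3)[OF that] by simp
    qed
    show "\<zeta> * (1 - s\<^sup>2) \<in> ?U"
      if "s \<in> path_image (linepath 1 (\<i> * of_real (\<rho> / 4)) +++ linepath (\<i> * of_real (\<rho> / 4)) (-1))" for s
      using half_loop_in_tube[OF \<rho> n1 that] .
  qed (use assms mem open_tube convex_tube G Z' in auto)
qed

section \<open>Persistence of the simple root under perturbation\<close>

lemma sw_P_deriv:
  "(sw_P N vs has_field_derivative of_nat N * z ^ (N - 1) - (\<Sum>n=1..N-2. vs n * (of_nat n * z ^ (n - 1)))) (at z)"
  unfolding sw_P_def by (auto intro!: derivative_eq_intros sum.cong)

text \<open>Newton's iteration with the derivative frozen at its unperturbed value c = N
  \<zeta>^(N-1). The map \<open>\<phi>\<close> is a contraction with constant 1/2, since 1/4 +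
  \<rho>/16 \<le> 1/2, and it moves \<zeta> by at most \<rho>/16; as \<rho>/2 + \<rho>/16 < \<rho>,
  the fixed point lies in the open ball. The same bound on 1 - P'/c makes the zero simple.\<close>

lemma sw_P_small_root:
  fixes \<zeta> :: complex
  assumes N: "N \<ge> 1" and \<zeta>: "\<zeta> ^ N = -1" and \<rho>: "0 < \<rho>" "\<rho> \<le> 1"
    and close: "\<And>z. z \<in> cball \<zeta> \<rho> \<Longrightarrow> norm (1 - (z / \<zeta>) ^ (N - 1)) \<le> 1/4"
    and vs: "(\<Sum>n=1..N-2. norm (vs n) * 2 ^ n) \<le> \<rho> / 16"
  obtains z\<^sub>0 where "z\<^sub>0 \<in> ball \<zeta> \<rho>" "sw_P N vs z\<^sub>0 = 0" "deriv (sw_P N vs) z\<^sub>0 \<noteq> 0"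
    "\<And>z. z \<in> cball \<zeta> \<rho> \<Longrightarrow> sw_P N vs z = 0 \<Longrightarrow> z = z\<^sub>0"
proof -
  let ?P = "sw_P N vs" and ?S = "cball \<zeta> \<rho>"
  define c where "c = of_nat N * \<zeta> ^ (N - 1)"
  define \<phi> where "\<phi> z = z - ?P z / c" for z
  have n1: "norm \<zeta> = 1" using norm_root_of_minus_one[OF \<zeta>] N by simp
  then have nz: "\<zeta> \<noteq> 0" by auto
  have nc: "norm c = real N" by (simp add: c_def norm_mult norm_power n1)
  then have cnz: "c \<noteq> 0" using N by auto
  have dP: "(?P has_field_derivative deriv ?P z) (at z)" for z
    using DERIV_imp_deriv[OF sw_P_deriv] sw_P_deriv by metis
  have der: "norm (1 - deriv ?P z / c) \<le> 1/2" if z: "z \<in> ?S" for z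
  proof -
    have nz2: "norm z \<le> 2"
      using z \<rho> n1 norm_triangle_sub[of z \<zeta>] by (simp add: dist_norm norm_minus_commute)
    define S where "S = (\<Sum>n=1..N-2. vs n * (of_nat n * z ^ (n - 1)))"
    have "1 - deriv ?P z / c = (1 - (z / \<zeta>) ^ (N - 1)) + S / c"
      unfolding DERIV_imp_deriv[OF sw_P_deriv] S_def[symmetric] using nz N
      by (simp add: c_def diff_divide_distrib power_divide)
    then have "norm (1 - deriv ?P z / c) \<le> norm (1 - (z / \<zeta>) ^ (N - 1)) + norm S / real N"
      using norm_triangle_ineq[of "1 - (z / \<zeta>) ^ (N - 1)" "S / c"] by (simp only: norm_divide nc)
    \<comment> \<open>The factors n \<le> N from differentiation are absorbed by |c| = N.\<close>
    also have "norm S / real N \<le> \<rho> / 16"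
    proof -
      have "norm S \<le> (\<Sum>n=1..N-2. real N * (norm (vs n) * 2 ^ n))"
        unfolding S_def
      proof (rule sum_norm_le)
        fix n assume n: "n \<in> {1..N-2}"
        have "norm (vs n * (of_nat n * z ^ (n - 1))) = norm (vs n) * (real n * norm z ^ (n - 1))"
          by (simp add: norm_mult norm_power)
        also have "\<dots> \<le> norm (vs n) * (real N * 2 ^ n)"
        proof (intro mult_left_mono mult_mono)
          have "norm z ^ (n - 1) \<le> 2 ^ (n - 1)" using nz2 by (intro power_mono) auto
          also have "\<dots> \<le> 2 ^ n" by (intro power_increasing) auto
          finally show "norm z ^ (n - 1) \<le> 2 ^ n" .
        qed (use n in auto)
        finally show "norm (vs n * (of_nat n * z ^ (n - 1))) \<le> real N * (norm (vs n) * 2 ^ n)" by (simp add: mult_ac)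
      qed
      also have "\<dots> \<le> real N * (\<rho> / 16)"
        unfolding sum_distrib_left[symmetric] using vs by (intro mult_left_mono) auto
      finally show ?thesis using N by (simp add: field_simps)
    qed
    finally show ?thesis using close[OF z] \<rho> by simp
  qed
  have lip: "norm (\<phi> x - \<phi> y) \<le> 1/2 * norm (x - y)" if "x \<in> ?S" "y \<in> ?S" for x y
  proof (rule field_differentiable_bound[OF convex_cball _ der that])
    show "(\<phi> has_field_derivative 1 - deriv ?P z / c) (at z within ?S)" for z
      unfolding \<phi>_def using cnz
      by (auto intro!: derivative_eq_intros has_field_derivative_at_within[OF dP])
  qed
  have "norm (\<phi> \<zeta> - \<zeta>) = norm (\<Sum>n=1..N-2. vs n * \<zeta> ^ n) / real N"
    by (simp add: \<phi>_def sw_P_def \<zeta> norm_divide nc)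
  also have "\<dots> \<le> norm (\<Sum>n=1..N-2. vs n * \<zeta> ^ n)"
    using N divide_left_mono[of 1 "real N" "norm (\<Sum>n=1..N-2. vs n * \<zeta> ^ n)"] by simp
  also have "\<dots> \<le> (\<Sum>n=1..N-2. norm (vs n) * 2 ^ n)"
  proof (rule sum_norm_le)
    show "norm (vs n * \<zeta> ^ n) \<le> norm (vs n) * 2 ^ n" for n
      using mult_left_mono[OF one_le_power[of "2 :: real" n], of "norm (vs n)"]
      by (simp add: norm_mult norm_power n1)
  qed
  finally have \<phi>\<zeta>: "norm (\<phi> \<zeta> - \<zeta>) \<le> \<rho> / 16" using vs by simp
  have near: "norm (\<phi> z - \<zeta>) \<le> 1/2 * norm (z - \<zeta>) + \<rho> / 16" if "z \<in> ?S" for z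
    using lip[OF that, of \<zeta>] \<phi>\<zeta> \<rho> norm_triangle_ineq[of "\<phi> z - \<phi> \<zeta>" "\<phi> \<zeta> - \<zeta>"] by simp
  have "\<exists>!z. z \<in> ?S \<and> \<phi> z = z"
  proof (rule Banach_fix[where c = "1/2"])
    show "\<phi> ` ?S \<subseteq> ?S"
    proof safe
      fix z assume "z \<in> ?S"
      with near[OF this] \<rho> show "\<phi> z \<in> ?S"
        by (simp add: dist_norm norm_minus_commute)
    qed
  qed (use lip \<rho> in \<open>auto simp: dist_norm complete_eq_closed\<close>)
  then obtain z\<^sub>0 where z\<^sub>0: "z\<^sub>0 \<in> ?S" "\<phi> z\<^sub>0 = z\<^sub>0" "\<And>z. z \<in> ?S \<Longrightarrow> \<phi> z = z \<Longrightarrow> z = z\<^sub>0"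
    by blast
  show thesis
  proof
    show "z\<^sub>0 \<in> ball \<zeta> \<rho>"
      using near[OF z\<^sub>0(1)] z\<^sub>0(2) \<rho> by (simp add: dist_norm norm_minus_commute)
    show "?P z\<^sub>0 = 0"
      using z\<^sub>0(2) cnz by (simp add: \<phi>_def)
    show "deriv ?P z\<^sub>0 \<noteq> 0"
      using der[OF z\<^sub>0(1)] by auto
    show "z = z\<^sub>0" if "z \<in> ?S" "?P z = 0" for z
      using z\<^sub>0(3)[OF that(1)] that(2) by (simp add: \<phi>_def)
  qed
qed

text \<open>Uniqueness of the root is required on the whole tube, not only near \<zeta>: the
  factorisation of P and the equation for E live on the tube.\<close>

locale sw_tube = perturbed N \<zeta> "tube \<zeta> \<rho>" H "\<rho> / 4" v vs m
  for N :: nat and \<zeta> :: complex and \<rho> :: real and H :: "complex \<Rightarrow> complex" and v :: complex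
    and vs :: "nat \<Rightarrow> complex" and m :: real +
  fixes lv z\<^sub>0 :: complex
  assumes lv: "exp lv = v"
    and z\<^sub>0: "z\<^sub>0 \<in> ball \<zeta> \<rho>" "sw_P N vs z\<^sub>0 = 0" "deriv (sw_P N vs) z\<^sub>0 \<noteq> 0"
      "\<And>z. z \<in> tube \<zeta> \<rho> \<Longrightarrow> sw_P N vs z = 0 \<Longrightarrow> z = z\<^sub>0"
begin

lemma ball_in_tube: "ball \<zeta> \<rho> \<subseteq> tube \<zeta> \<rho>"
  unfolding tube_def by (intro UN_upper) simp

lemma z\<^sub>0_in_tube: "z\<^sub>0 \<in> tube \<zeta> \<rho>"
  using z\<^sub>0(1) ball_in_tube by blast

lemma unique_root: "\<exists>!z. z \<in> ball \<zeta> \<rho> \<and> P z = 0"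
  using z\<^sub>0 ball_in_tube by blast

lemma small_root_eq: "small_root N \<rho> \<zeta> vs = z\<^sub>0"
  unfolding small_root_def using unique_root z\<^sub>0 by (intro the1_equality) auto

lemma P_0: "P 0 = 1"
  using N by (simp add: sw_P_def power_0_left)

lemma P_holomorphic: "P holomorphic_on A"
  unfolding sw_P_def by (intro holomorphic_intros)

lemma vP_not_nonpos: "1 - v / 2 * P z \<notin> \<real>\<^sub>\<le>\<^sub>0" if "z \<in> tube \<zeta> \<rho>"
  using order_trans[OF complex_Re_le_cmod norm_vP_le[OF that]]
  by (simp add: complex_nonpos_Reals_iff)

lemma csqrt_vP_nz: "csqrt (1 - v / 2 * P z) \<noteq> 0" if "z \<in> tube \<zeta> \<rho>"
proof
  assume "csqrt (1 - v / 2 * P z) = 0"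
  then have "1 - v / 2 * P z = 0" by (simp only: csqrt_eq_0)
  with vP_not_nonpos[OF that] show False by (metis nonpos_Reals_zero_I)
qed

text \<open>The z-integrand of \<lambda> up to constants, without P^(-1/2). The other root is
  principal throughout, since |v P / 2| \<le> 1/4 on the tube.\<close>

definition f :: "complex \<Rightarrow> complex" where
  "f z = z * deriv P z / csqrt (1 - v / 2 * P z)"

lemma f_holomorphic: "f holomorphic_on tube \<zeta> \<rho>"
proof -
  have dP: "deriv P holomorphic_on tube \<zeta> \<rho>"
    by (intro holomorphic_deriv P_holomorphic open_tube)
  have den: "(\<lambda>z. csqrt (1 - v / 2 * P z)) holomorphic_on tube \<zeta> \<rho>"
  proof -
    have "csqrt \<circ> (\<lambda>z. 1 - v / 2 * P z) holomorphic_on tube \<zeta> \<rho>"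
      by (rule holomorphic_on_compose_gen[OF _ holomorphic_on_csqrt])
        (use vP_not_nonpos in \<open>auto intro!: holomorphic_intros P_holomorphic\<close>)
    then show ?thesis by (simp add: o_def)
  qed
  show ?thesis
    unfolding f_def
    by (rule holomorphic_on_divide[OF holomorphic_on_mult[OF holomorphic_on_ident dP] den csqrt_vP_nz])
qed

lemma continuous_csqrt_vP:
  assumes "continuous_on {0..1} \<gamma>" "\<And>t. t \<in> {0..1} \<Longrightarrow> \<gamma> t \<in> tube \<zeta> \<rho>"
  shows "continuous_on {0..1} (\<lambda>t. csqrt (1 - v / 2 * P (\<gamma> t)))"
proof -
  have "continuous_on {0..1} (\<lambda>t. P (\<gamma> t))"
    by (rule continuous_on_compose2[OF continuous_P[of UNIV] assms(1)]) simp
  then show ?thesis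
    using vP_not_nonpos assms(2)
    by (intro continuous_on_compose2[OF continuous_on_csqrt]) (auto intro!: continuous_intros)
qed

text \<open>Shows that the claim about all admissible paths is not vacuous. On the straight path to
  the root, \<gamma> t minus the root is -(1 - t) times the root, so P^(1/2) continues explicitly as
  (1 - t)^(1/2) times the zero-free G along \<gamma>, normalised at 0.\<close>

lemma path_exists: "\<exists>\<gamma> p q. sw_path N \<rho> \<zeta> lv vs \<gamma> p q"
proof -
  obtain G where G: "G holomorphic_on tube \<zeta> \<rho>" "\<And>z. z \<in> tube \<zeta> \<rho> \<Longrightarrow> G z \<noteq> 0"
    "\<And>z. z \<in> tube \<zeta> \<rho> \<Longrightarrow> P z = (z - z\<^sub>0) * (G z)\<^sup>2"
    using simple_zero_sqrt_factor[OF open_tube convex_tube P_holomorphic z\<^sub>0_in_tube z\<^sub>0(2,3,4)] by blast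
  have G0: "1 = - z\<^sub>0 * (G 0)\<^sup>2"
    using G(3)[OF U(3)] P_0 by simp
  let ?\<gamma> = "linepath 0 z\<^sub>0"
  define p where "p t = of_real (sqrt (1 - t)) * G (?\<gamma> t) / G 0" for t
  define q where "q t = csqrt (1 - v / 2 * P (?\<gamma> t))" for t
  have dist: "dist (?\<gamma> t) (linepath 0 \<zeta> t) < \<rho>" if "t \<in> {0..1}" for t
  proof -
    have "?\<gamma> t - linepath 0 \<zeta> t = t *\<^sub>R (z\<^sub>0 - \<zeta>)"
      by (simp add: linepath_def scaleR_diff_right)
    then have "dist (?\<gamma> t) (linepath 0 \<zeta> t) \<le> 1 * norm (z\<^sub>0 - \<zeta>)"
      using that unfolding dist_norm by (simp add: mult_left_le_one_le)
    then show ?thesis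
      using z\<^sub>0(1) by (simp add: dist_norm norm_minus_commute)
  qed
  have in_tube: "?\<gamma> t \<in> tube \<zeta> \<rho>" if "t \<in> {0..1}" for t
    using linepath_nearby_tube[OF dist[OF that] that] .
  have "sw_path N \<rho> \<zeta> lv vs ?\<gamma> p q"
    unfolding sw_path_def small_root_eq lv
  proof (intro conjI ballI)
    show "P (?\<gamma> t) \<noteq> 0" if "t \<in> {0..<1}" for t
    proof
      assume "P (?\<gamma> t) = 0"
      then have "?\<gamma> t = z\<^sub>0" using z\<^sub>0(4)[OF in_tube] that by simp
      then have "(1 - t) *\<^sub>R z\<^sub>0 = 0" by (simp add: linepath_def scaleR_diff_left)
      then show False using that G0 by auto
    qed
    show "continued_sqrt (\<lambda>t. P (?\<gamma> t)) 1 p"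
      unfolding continued_sqrt_def
    proof (intro conjI ballI)
      have "continuous_on {0..1} (\<lambda>t. G (?\<gamma> t))"
        using in_tube
        by (intro continuous_on_compose2[OF holomorphic_on_imp_continuous_on[OF G(1)] continuous_on_linepath]) auto
      then show "continuous_on {0..1} p"
        unfolding p_def using G(2)[OF U(3)] by (intro continuous_intros) auto
      show "(p t)\<^sup>2 = P (?\<gamma> t)" if "t \<in> {0..1}" for t
      proof -
        have "(p t)\<^sup>2 = of_real ((sqrt (1 - t))\<^sup>2) * (G (?\<gamma> t))\<^sup>2 * inverse ((G 0)\<^sup>2)"
          by (simp add: p_def power_mult_distrib power_divide divide_inverse power_inverse)
        also have "inverse ((G 0)\<^sup>2) = - z\<^sub>0"
          using inverse_unique[of "(G 0)\<^sup>2" "- z\<^sub>0"] G0 by (simp add: mult.commute)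
        also have "of_real ((sqrt (1 - t))\<^sup>2) * (G (?\<gamma> t))\<^sup>2 * - z\<^sub>0 = (?\<gamma> t - z\<^sub>0) * (G (?\<gamma> t))\<^sup>2"
          using that by (simp add: linepath_def scaleR_conv_of_real algebra_simps)
        finally show ?thesis using G(3)[OF in_tube[OF that]] by simp
      qed
      show "p 0 = 1" using G(2)[OF U(3)] by (simp add: p_def)
    qed
    show "continued_sqrt (\<lambda>t. 1 - v / 2 * P (?\<gamma> t)) (csqrt (1 - v / 2)) q"
      unfolding continued_sqrt_def q_def
    proof (intro conjI ballI)
      show "continuous_on {0..1} (\<lambda>t. csqrt (1 - v / 2 * P (?\<gamma> t)))"
        by (rule continuous_csqrt_vP[OF continuous_on_linepath in_tube])
    qed (simp_all add: P_0 linepath_def)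
  qed (use dist in \<open>simp_all del: linepath_0\<close>)
  then show ?thesis by blast
qed

lemma sw_lambda_has_integral:
  assumes path: "sw_path N \<rho> \<zeta> lv vs \<gamma> p q"
    and E: "E holomorphic_on tube \<zeta> \<rho>" "\<And>z. z \<in> tube \<zeta> \<rho> \<Longrightarrow> P z * deriv E z + deriv P z * E z / 2 = f z"
  shows "(sw_lambda N lv vs \<gamma> p q has_integral
    vpow lv (1/2 + 1 / real N) / (- \<i> * of_real (sqrt 2)) * - E 0) {0..1}"
proof -
  have \<gamma>: "valid_path \<gamma>" "pathstart \<gamma> = 0" "pathfinish \<gamma> = z\<^sub>0"
    and near: "\<And>t. t \<in> {0..1} \<Longrightarrow> dist (\<gamma> t) (linepath 0 \<zeta> t) < \<rho>"
    and nz: "\<And>t. t \<in> {0..<1} \<Longrightarrow> P (\<gamma> t) \<noteq> 0"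
    and p: "continued_sqrt (\<lambda>t. P (\<gamma> t)) 1 p"
    and q: "continued_sqrt (\<lambda>t. 1 - v / 2 * P (\<gamma> t)) (csqrt (1 - v / 2)) q"
    using path unfolding sw_path_def small_root_eq lv by auto
  have in_tube: "\<gamma> t \<in> tube \<zeta> \<rho>" if "t \<in> {0..1}" for t
    using linepath_nearby_tube[OF near[OF that] that] .
  have c\<gamma>: "continuous_on {0..1} \<gamma>"
    using valid_path_imp_path[OF \<gamma>(1)] by (simp add: path_def)
  \<comment> \<open>The second root never vanishes on the tube, so its continuation from the
    principal value at 0 remains principal.\<close>
  have q_eq: "q t = csqrt (1 - v / 2 * P (\<gamma> t))" if "t \<in> {0..1}" for t
  proof (rule continuous_sqrt_unique[OF _ continuous_csqrt_vP[OF c\<gamma> in_tube] _ _ _ that])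
    show "q 0 = csqrt (1 - v / 2 * P (\<gamma> 0))"
      using q \<gamma>(2) by (simp add: continued_sqrt_def pathstart_def P_0)
  qed (use q in_tube csqrt_vP_nz in \<open>auto simp: continued_sqrt_def\<close>)
  have "((\<lambda>t. f (\<gamma> t) / p t * vector_derivative \<gamma> (at t within {0..1})) has_integral
      - (1 * E (pathstart \<gamma>))) {0..1}"
    by (rule has_integral_continued_sqrt[OF open_tube P_holomorphic E \<gamma>(1) _ p nz])
      (use in_tube \<gamma> z\<^sub>0 in \<open>auto simp: path_image_def\<close>)
  then have int: "((\<lambda>t. vpow lv (1/2 + 1 / real N) / (- \<i> * of_real (sqrt 2)) *
      (f (\<gamma> t) / p t * vector_derivative \<gamma> (at t within {0..1}))) has_integral
      vpow lv (1/2 + 1 / real N) / (- \<i> * of_real (sqrt 2)) * - E 0) {0..1}"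
    unfolding \<gamma>(2) mult_1_left by (rule has_integral_mult_right)
  obtain S where S: "finite S" "\<And>t. t \<in> {0..1} - S \<Longrightarrow> \<gamma> differentiable at t"
    using \<gamma>(1) unfolding valid_path_def piecewise_C1_differentiable_on_def C1_differentiable_on_eq by blast
  show ?thesis
  proof (rule has_integral_spike_finite[OF S(1) _ int])
    fix t assume t: "t \<in> {0..1} - S"
    have d: "\<gamma> differentiable (at t within {0..1})"
      using S(2)[OF t] by (rule differentiable_at_withinI)
    have "N \<ge> 2" "t \<in> {0..1}" using N t by auto
    from sw_lambda_rescaled[OF this d] q_eq[OF this(2)]
    show "sw_lambda N lv vs \<gamma> p q t = vpow lv (1/2 + 1 / real N) / (- \<i> * of_real (sqrt 2)) *
      (f (\<gamma> t) / p t * vector_derivative \<gamma> (at t within {0..1}))"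
      by (simp add: f_def mult_ac)
  qed
qed

lemma sw_R_series:
  "R_term N \<zeta> v vs summable_on ({0..N-2} \<rightarrow>\<^sub>E UNIV)"
  "sw_path N \<rho> \<zeta> lv vs \<gamma> p q \<Longrightarrow> sw_lambda N lv vs \<gamma> p q integrable_on {0..1} \<and>
     sw_R N lv vs \<gamma> p q = vpow lv (1/2 + 1 / real N) / of_real (sqrt (2 * pi) * real N) *
       (\<Sum>\<^sub>\<infinity>l\<in>{0..N-2} \<rightarrow>\<^sub>E UNIV. R_term N \<zeta> v vs l)"
proof -
  obtain E where E: "E holomorphic_on tube \<zeta> \<rho>" "\<And>z. z \<in> tube \<zeta> \<rho> \<Longrightarrow> P z * deriv E z + deriv P z * E z / 2 = f z"
    using singular_ode_solution[OF open_tube convex_tube P_holomorphic f_holomorphic z\<^sub>0_in_tube z\<^sub>0(2,3,4)] by blast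
  have hs: "(R_term N \<zeta> v vs has_sum - (of_nat N / of_real (sqrt pi)) * E 0) ({0..N-2} \<rightarrow>\<^sub>E UNIV)"
    by (rule R_term_has_sum[OF E(1)]) (use E(2) in \<open>simp add: f_def\<close>)
  then show "R_term N \<zeta> v vs summable_on ({0..N-2} \<rightarrow>\<^sub>E UNIV)"
    by (auto simp: summable_on_def)
  assume "sw_path N \<rho> \<zeta> lv vs \<gamma> p q"
  note int = sw_lambda_has_integral[OF this E]
  have "sw_R N lv vs \<gamma> p q = vpow lv (1/2 + 1 / real N) / (- \<i> * of_real (sqrt 2)) * - E 0 / (\<i> * of_real pi)"
    by (simp only: sw_R_def integral_unique[OF int])
  \<comment> \<open>Here (-i)(i) = 1, and 1 / (sqrt 2 pi) is split as 1 / sqrt(2 pi) times 1 / sqrt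
    pi; the factor N is inserted on both sides.\<close>
  also have "\<dots> = vpow lv (1/2 + 1 / real N) / of_real (sqrt (2 * pi) * real N) * (- (of_nat N / of_real (sqrt pi)) * E 0)"
  proof -
    have "complex_of_real (sqrt pi) * complex_of_real (sqrt pi) = of_real pi"
      by (simp flip: of_real_mult)
    then have sp: "complex_of_real (sqrt pi) * (complex_of_real (sqrt pi) * x) = of_real pi * x" for x
      by (simp flip: mult.assoc)
    show ?thesis
      using N by (simp add: real_sqrt_mult field_simps sp)
  qed
  finally show "sw_lambda N lv vs \<gamma> p q integrable_on {0..1} \<and>
     sw_R N lv vs \<gamma> p q = vpow lv (1/2 + 1 / real N) / of_real (sqrt (2 * pi) * real N) *
       (\<Sum>\<^sub>\<infinity>l\<in>{0..N-2} \<rightarrow>\<^sub>E UNIV. R_term N \<zeta> v vs l)"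
    using int infsumI[OF hs] by (auto simp: has_integral_integrable)
qed

end

theorem theorem2p1:
  fixes N :: nat and \<zeta> :: complex
  assumes "N \<ge> 3" and "\<zeta> ^ N = -1"
  shows "\<exists>\<rho>>0. \<exists>\<epsilon>>0. \<forall>v lv :: complex. \<forall>vs :: nat \<Rightarrow> complex.
           0 < norm v \<and> norm v < \<epsilon> \<and> exp lv = v \<and> (\<forall>n\<in>{1..N-2}. norm (vs n) < \<epsilon>) \<longrightarrow>
             (\<exists>!z. z \<in> ball \<zeta> \<rho> \<and> sw_P N vs z = 0) \<and>
             (\<exists>\<gamma> p q. sw_path N \<rho> \<zeta> lv vs \<gamma> p q) \<and>
             R_term N \<zeta> v vs summable_on ({0..N-2} \<rightarrow>\<^sub>E UNIV) \<and>
             (\<forall>\<gamma> p q. sw_path N \<rho> \<zeta> lv vs \<gamma> p q \<longrightarrow>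
                sw_lambda N lv vs \<gamma> p q integrable_on {0..1} \<and>
                sw_R N lv vs \<gamma> p q =
                  vpow lv (1/2 + 1 / real N) / of_real (sqrt (2 * pi) * real N) *
                  (\<Sum>\<^sub>\<infinity>l\<in>{0..N-2} \<rightarrow>\<^sub>E UNIV. R_term N \<zeta> v vs l))"
proof -
  have N1: "N \<ge> 1" and n1: "norm \<zeta> = 1"
    using assms norm_root_of_minus_one[OF assms(2)] by auto
  obtain \<rho> where \<rho>: "0 < \<rho>" "\<rho> \<le> 1" "\<And>z. z \<in> cball \<zeta> \<rho> \<Longrightarrow> norm (1 - (z / \<zeta>) ^ (N - 1)) \<le> 1/4"
    "\<And>z. z \<in> ctube \<zeta> \<rho> \<Longrightarrow> 1 + z ^ N = 0 \<Longrightarrow> z = \<zeta>"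
    using tube_radius[OF N1 assms(2)] by blast
  obtain H where "half_loop N \<zeta> (tube \<zeta> \<rho>) H (\<rho> / 4)"
    using half_loop_tube[OF assms \<rho>(1,2,4)] by blast
  then interpret half_loop N \<zeta> "tube \<zeta> \<rho>" H "\<rho> / 4" .
  have tube_le: "norm z \<le> 2" if "z \<in> tube \<zeta> \<rho>" for z
    using norm_ctube_le[OF _ n1, of z \<rho>] that tube_subset_ctube \<rho>(2) by fastforce
  have "compact (ctube \<zeta> \<rho> - ball \<zeta> \<rho>)"
    by (intro compact_diff compact_ctube open_ball)
  moreover have Q_cont: "continuous_on A Q" for A
    unfolding Q_def by (intro continuous_intros)
  moreover have "Q z \<noteq> 0" if "z \<in> ctube \<zeta> \<rho> - ball \<zeta> \<rho>" for z
    using that \<rho>(1) \<rho>(4)[of z] by (auto simp: Q_def)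
  ultimately obtain m1 where m1: "0 < m1" "\<And>z. z \<in> ctube \<zeta> \<rho> - ball \<zeta> \<rho> \<Longrightarrow> m1 \<le> norm (Q z)"
    using compact_norm_lower_bound[of "ctube \<zeta> \<rho> - ball \<zeta> \<rho>" Q] by blast
  have "compact (w ` path_image loop)"
    unfolding w_def using valid_path_imp_path[OF loop_simps(3)]
    by (intro compact_continuous_image compact_path_image continuous_intros) auto
  then obtain m2 where m2: "0 < m2" "\<And>z. z \<in> w ` path_image loop \<Longrightarrow> m2 \<le> norm (Q z)"
    using compact_norm_lower_bound[OF _ Q_cont Q_nz] by blast
  define m where "m = min 1 (min m1 m2)"
  \<comment> \<open>A common bound for the weighted sum of the |v_n|: below m it keeps P zero-free
    off the ball and the expansion convergent on the loop, and \<rho>/16 is what the root lemma asks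
    for.\<close>
  define \<kappa> where "\<kappa> = min m \<rho> / 16"
  define S where "S = (\<Sum>n=1..N-2. 2 ^ n :: real)"
  \<comment> \<open>The first entry bounds the weighted sum of the |v_n| by \<kappa>, the second
    makes |v| (2^N + 2) \<le> 1/2. Neither refers to the branch \<open>lv\<close>.\<close>
  define \<epsilon> where "\<epsilon> = min (\<kappa> / (1 + S)) (1 / (2 * (2 ^ N + 2)))"
  have m: "0 < m" "m \<le> 1" "m \<le> m1" "m \<le> m2"
    using m1(1) m2(1) by (auto simp: m_def)
  have \<kappa>: "0 < \<kappa>" "\<kappa> \<le> m / 16" "\<kappa> \<le> \<rho> / 16"
    using m \<rho> by (auto simp: \<kappa>_def)
  have S: "0 \<le> S" by (auto simp: S_def intro: sum_nonneg)
  have \<epsilon>: "0 < \<epsilon>"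
    using \<kappa> S by (auto simp: \<epsilon>_def add_pos_nonneg)
  show ?thesis
  proof (rule exI[of _ \<rho>], rule conjI[OF \<rho>(1)], rule exI[of _ \<epsilon>], rule conjI[OF \<epsilon>], intro conjI allI impI)
    fix v lv :: complex and vs :: "nat \<Rightarrow> complex"
    assume "0 < norm v \<and> norm v < \<epsilon> \<and> exp lv = v \<and> (\<forall>n\<in>{1..N-2}. norm (vs n) < \<epsilon>)"
    then have v: "norm v < \<epsilon>" "exp lv = v" and vs: "\<And>n. n \<in> {1..N-2} \<Longrightarrow> norm (vs n) < \<epsilon>"
      by auto
    have "(\<Sum>n=1..N-2. norm (vs n) * 2 ^ n) \<le> (\<Sum>n=1..N-2. \<epsilon> * 2 ^ n)"
      using vs by (intro sum_mono mult_right_mono) (auto intro: less_imp_le)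
    also have "\<dots> = \<epsilon> * S"
      by (simp add: S_def sum_distrib_left)
    also have "\<dots> \<le> \<kappa> / (1 + S) * (1 + S)"
      using S \<kappa> by (intro mult_mono) (auto simp: \<epsilon>_def)
    finally have \<eta>: "(\<Sum>n=1..N-2. norm (vs n) * 2 ^ n) \<le> \<kappa>"
      using S by simp
    obtain z\<^sub>0 where z\<^sub>0: "z\<^sub>0 \<in> ball \<zeta> \<rho>" "sw_P N vs z\<^sub>0 = 0" "deriv (sw_P N vs) z\<^sub>0 \<noteq> 0"
      "\<And>z. z \<in> cball \<zeta> \<rho> \<Longrightarrow> sw_P N vs z = 0 \<Longrightarrow> z = z\<^sub>0"
      using sw_P_small_root[OF N1 assms(2) \<rho>(1-3) order_trans[OF \<eta> \<kappa>(3)]] by blast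
    \<comment> \<open>Outside the closed ball a root of P would satisfy m1 \<le> |Q z| = |q z| \<le>
      \<kappa> \<le> m/16 < m1.\<close>
    have uniq: "z = z\<^sub>0" if z: "z \<in> tube \<zeta> \<rho>" "sw_P N vs z = 0" for z
    proof (cases "z \<in> cball \<zeta> \<rho>")
      case False
      have "norm (\<Sum>n=1..N-2. vs n * z ^ n) \<le> (\<Sum>n=1..N-2. norm (vs n) * 2 ^ n)"
        using tube_le[OF z(1)]
        by (intro sum_norm_le) (auto simp: norm_mult norm_power intro!: mult_left_mono power_mono)
      moreover have "(\<Sum>n=1..N-2. vs n * z ^ n) = Q z"
        using z(2) by (simp add: sw_P_def Q_def algebra_simps)
      moreover have "m1 \<le> norm (Q z)"
        using m1(2)[of z] False subsetD[OF tube_subset_ctube z(1)] by simp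
      ultimately show ?thesis
        using \<eta> \<kappa> m by simp
    qed (use z\<^sub>0 z in blast)
    have "0 < 2 * ((2 :: real) ^ N + 2)" by (intro mult_pos_pos add_pos_pos) auto
    moreover have "norm v < 1 / (2 * (2 ^ N + 2))" using v(1) by (simp add: \<epsilon>_def)
    ultimately have "norm v * (2 * (2 ^ N + 2)) < 1" by (simp only: pos_less_divide_eq)
    then have v_small: "norm v * (2 ^ N + 2) \<le> 1/2" by (simp add: algebra_simps)
    interpret sw_tube N \<zeta> \<rho> H v vs m lv z\<^sub>0
      by unfold_locales (use m m2(2) tube_le \<eta> \<kappa> v_small v z\<^sub>0 uniq in \<open>auto intro: order_trans\<close>)
    show "\<exists>!z. z \<in> ball \<zeta> \<rho> \<and> sw_P N vs z = 0"
      by (rule unique_root)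
    show "\<exists>\<gamma> p q. sw_path N \<rho> \<zeta> lv vs \<gamma> p q"
      by (rule path_exists)
    show "R_term N \<zeta> v vs summable_on ({0..N-2} \<rightarrow>\<^sub>E UNIV)"
      by (rule sw_R_series(1))
    fix \<gamma> p q
    assume path: "sw_path N \<rho> \<zeta> lv vs \<gamma> p q"
    show "sw_lambda N lv vs \<gamma> p q integrable_on {0..1}"
      using sw_R_series(2)[OF path] by blast
    show "sw_R N lv vs \<gamma> p q = vpow lv (1/2 + 1 / real N) / of_real (sqrt (2 * pi) * real N) *
        (\<Sum>\<^sub>\<infinity>l\<in>{0..N-2} \<rightarrow>\<^sub>E UNIV. R_term N \<zeta> v vs l)"
      using sw_R_series(2)[OF path] by blast
  qed
qed

end
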